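(* Fix an integer $k\ge 2$ and let $M,N,L$ be $H_\infty$-double cosets in $S_\infty$ (equivalently, modified coset types). For positive integers $n$ such that $M(n),N(n),L(n)$ are all non-empty: (1) if $\|M\|+\|N\|<\|L\|$, then $c_{M,N}^L(n)=0$; (2) if $\|M\|+\|N\|\ge\|L\|$, then $c_{M,N}^L(n)\ge 0$; (3) if $\|L\|=\|M\|+\|N\|$, then $c_{M,N}^L(n)$ is constant, i.e. independent of $n$.
   Context: Fix an integer $k\ge 2$. $\mathbb{N}_+$ is the set of positive integers and $[n]=\{1,\dots,n\}$. $S_\infty$ is the group of permutations of $\mathbb{N}_+$ with finite support; $S_{kn}$ is the group of permutations of $[kn]$, viewed inside $S_\infty$ (fixing everything outside $[kn]$). For $i\in\mathbb{N}_+$ let $\Gamma_i=\{k(i-1)+1,\dots,ki\}$, and write $p(r)=i$ if $r\in\Gamma_i$. $H_\infty$ is the subgroup of those $h\in S_\infty$ such that $p(r)=p(s)$ implies $p(h(r))=p(h(s))$, i.e. those permuting the sets $\Gamma_i$; $H_n=H_\infty\cap S_{kn}\cong S_k\wr S_n$. For an $H_\infty$-double coset $M$ in $S_\infty$ put $M(n)=M\cap S_{kn}$; it is either empty or a single $H_n$-double coset of $S_{kn}$, and every $H_n$-double coset in $S_{kn}$ is $M(n)$ for a unique $M$. If $M(n)\ne\emptyset$, put $S_M(n)=\frac{1}{|H_n|}\sum_{g\in M(n)}g\in\mathbb{C}[S_{kn}]$. These elements form a basis of the Hecke algebra of the pair $(S_{kn},H_n)$, and the structure coefficients $c_{M,N}^L(n)$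 are defined (for $n$ with $M(n),N(n)\neq\emptyset$) by $S_M(n)\cdot S_N(n)=\sum_{L:\,L(n)\ne\emptyset}c_{M,N}^L(n)\,S_L(n)$. For $g\in S_{kn}$, the graph $G_g$ (loops and multiple edges allowed) has vertices $v_1,\dots,v_n$, and for each $u\in[n]$ and each two-element subset $\{r,s\}\subset\Gamma_u$ it has one edge $e^g_{r,s}$ joining $v_{p(g^{-1}(r))}$ and $v_{p(g^{-1}(s))}$ (a loop if these coincide). The modified coset type of $g$ is the graph obtained from $G_g$ by removing the connected components that consist of a single vertex. The weight of a finite graph is (number of vertices) minus (number of connected components). For an $H_\infty$-double coset $M$, $\|M\|$ denotes the weight of $G_g$ (equivalently, of the modified coset type of $g$) for any $g\in M$ and any $n$ with $g\in S_{kn}$; it does not depend on these choices. *)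

theory Defs
  imports
    Complex_Main
    "HOL-Combinatorics.Permutations"
    "HOL-Library.Nonpos_Ints"
begin

section \<open>Permutations and blocks\<close>

text \<open>
  Permutations of the positive integers are functions on \<^typ>\<open>nat\<close> that fix \<open>0\<close>.  As usual for
  \<^const>\<open>permutes\<close>, a permutation of \<open>{1..k * n}\<close> fixes everything outside of it, so the finite
  symmetric groups are literally contained in the infinite one.  The group product is composition.
\<close>

definition S_inf :: "(nat \<Rightarrow> nat) set" where
  "S_inf = {g. g permutes {1..} \<and> finite {x. g x \<noteq> x}}"

definition S_fin :: "nat \<Rightarrow> nat \<Rightarrow> (nat \<Rightarrow> nat) set" where
  "S_fin k n = {g. g permutes {1..k * n}}"

definition Gam :: "nat \<Rightarrow> nat \<Rightarrow> nat set" where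
  "Gam k i = {k * (i - 1) + 1..k * i}"

definition blk :: "nat \<Rightarrow> nat \<Rightarrow> nat" where
  "blk k r = (THE i. i \<ge> 1 \<and> r \<in> Gam k i)"

lemma blk_eqI:
  assumes "i \<ge> 1" "r \<in> Gam k i"
  shows "blk k r = i"
proof -
  have le: "j \<le> l" if "j \<ge> 1" "r \<in> Gam k j" "r \<in> Gam k l" for j l
  proof (rule ccontr)
    assume "\<not> j \<le> l"
    then have "k * l \<le> k * (j - 1)" by (intro mult_le_mono2) linarith
    moreover have "k * (j - 1) + 1 \<le> r" "r \<le> k * l"
      using that(2,3) unfolding Gam_def by simp_all
    ultimately show False by linarith
  qed
  have "j = i" if "j \<ge> 1 \<and> r \<in> Gam k j" for j
    using le[of i j] le[of j i] that assms by (blast intro: antisym)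
  then show ?thesis
    unfolding blk_def using assms by (intro the_equality) blast+
qed

lemma blk_eq:
  assumes "k \<ge> 1" "r \<ge> 1"
  shows "blk k r = (r - 1) div k + 1"
proof (rule blk_eqI)
  have "k * ((r - 1) div k) + (r - 1) mod k = r - 1" by (rule mult_div_mod_eq)
  moreover have "(r - 1) mod k < k" using assms by (intro mod_less_divisor) linarith
  moreover have "k * ((r - 1) div k + 1) = k * ((r - 1) div k) + k" by (simp only: distrib_left mult_1_right)
  ultimately have "k * ((r - 1) div k) + 1 \<le> r \<and> r \<le> k * ((r - 1) div k + 1)"
    using assms(2) by linarith
  then show "r \<in> Gam k ((r - 1) div k + 1)"
    unfolding Gam_def atLeastAtMost_iff add_diff_cancel_right' .
qed linarith

definition H_inf :: "nat \<Rightarrow> (nat \<Rightarrow> nat) set" where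
  "H_inf k = {h \<in> S_inf. \<forall>r\<ge>1. \<forall>s\<ge>1. blk k r = blk k s \<longrightarrow> blk k (h r) = blk k (h s)}"

definition H_fin :: "nat \<Rightarrow> nat \<Rightarrow> (nat \<Rightarrow> nat) set" where
  "H_fin k n = H_inf k \<inter> S_fin k n"

section \<open>Double cosets\<close>

definition double_coset :: "nat \<Rightarrow> (nat \<Rightarrow> nat) \<Rightarrow> (nat \<Rightarrow> nat) set" where
  "double_coset k g = {h \<circ> g \<circ> h' | h h'. h \<in> H_inf k \<and> h' \<in> H_inf k}"

definition double_cosets :: "nat \<Rightarrow> (nat \<Rightarrow> nat) set set" where
  "double_cosets k = double_coset k ` S_inf"

definition level :: "nat \<Rightarrow> (nat \<Rightarrow> nat) set \<Rightarrow> nat \<Rightarrow> (nat \<Rightarrow> nat) set" where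
  "level k M n = M \<inter> S_fin k n"

section \<open>The group algebra and the structure coefficients\<close>

text \<open>
  An element of the complex group algebra of \<^term>\<open>S_fin k n\<close> is represented by its coefficient
  function, which vanishes outside of \<^term>\<open>S_fin k n\<close>.
\<close>

type_synonym galg = "(nat \<Rightarrow> nat) \<Rightarrow> complex"

definition basis_elt :: "(nat \<Rightarrow> nat) \<Rightarrow> galg" where
  "basis_elt g = (\<lambda>x. if x = g then 1 else 0)"

definition galg_mult :: "nat \<Rightarrow> nat \<Rightarrow> galg \<Rightarrow> galg \<Rightarrow> galg" where
  "galg_mult k n \<alpha> \<beta> =
     (\<lambda>x. \<Sum>(a, b) \<in> {(a, b). a \<in> S_fin k n \<and> b \<in> S_fin k n \<and> a \<circ> b = x}. \<alpha> a * \<beta> b)"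

definition S_elt :: "nat \<Rightarrow> (nat \<Rightarrow> nat) set \<Rightarrow> nat \<Rightarrow> galg" where
  "S_elt k M n = (\<lambda>x. 1 / of_nat (card (H_fin k n)) * (\<Sum>g\<in>level k M n. basis_elt g x))"

text \<open>The double cosets indexing the basis of the Hecke algebra at level \<open>n\<close>.\<close>

definition index_set :: "nat \<Rightarrow> nat \<Rightarrow> (nat \<Rightarrow> nat) set set" where
  "index_set k n = {L \<in> double_cosets k. level k L n \<noteq> {}}"

definition is_expansion ::
    "nat \<Rightarrow> (nat \<Rightarrow> nat) set \<Rightarrow> (nat \<Rightarrow> nat) set \<Rightarrow> nat \<Rightarrow> ((nat \<Rightarrow> nat) set \<Rightarrow> complex) \<Rightarrow> bool" where
  "is_expansion k M N n c \<longleftrightarrow>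
     galg_mult k n (S_elt k M n) (S_elt k N n) = (\<lambda>x. \<Sum>L\<in>index_set k n. c L * S_elt k L n x)"

text \<open>
  The family \<open>c\<close> in an expansion is determined only on \<^const>\<open>index_set\<close>; accordingly the
  coefficient below is meaningful for \<open>L\<close> in that set.
\<close>

definition struct_coeff ::
    "nat \<Rightarrow> (nat \<Rightarrow> nat) set \<Rightarrow> (nat \<Rightarrow> nat) set \<Rightarrow> (nat \<Rightarrow> nat) set \<Rightarrow> nat \<Rightarrow> complex" where
  "struct_coeff k M N L n = (THE z. \<exists>c. is_expansion k M N n c \<and> z = c L)"

section \<open>Graphs and weights\<close>

text \<open>
  Graphs with loops and multiple edges: \<open>ends\<close> sends an edge to its set of endpoints, which has one
  element for a loop and two elements otherwise.
\<close>

record ('v, 'e) multigraph =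
  verts :: "'v set"
  edges :: "'e set"
  ends :: "'e \<Rightarrow> 'v set"

definition adjacency :: "('v, 'e) multigraph \<Rightarrow> ('v \<times> 'v) set" where
  "adjacency G = {(x, y). \<exists>e\<in>edges G. ends G e = {x, y}}"

definition components :: "('v, 'e) multigraph \<Rightarrow> 'v set set" where
  "components G = verts G // (adjacency G)\<^sup>*"

definition weight :: "('v, 'e) multigraph \<Rightarrow> int" where
  "weight G = int (card (verts G)) - int (card (components G))"

text \<open>
  The vertex \<open>v\<^sub>i\<close> is represented by \<open>i\<close>, and the edge coming from a two-element set \<open>{r, s}\<close> by this
  set itself.
\<close>

definition coset_graph :: "nat \<Rightarrow> nat \<Rightarrow> (nat \<Rightarrow> nat) \<Rightarrow> (nat, nat set) multigraph" where
  "coset_graph k n g =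
     \<lparr> verts = {1..n},
       edges = {e. card e = 2 \<and> (\<exists>u\<in>{1..n}. e \<subseteq> Gam k u)},
       ends = (\<lambda>e. (\<lambda>r. blk k (inv g r)) ` e) \<rparr>"

text \<open>The weight of the graph is the same for all representatives and all levels.\<close>

definition coset_weight :: "nat \<Rightarrow> (nat \<Rightarrow> nat) set \<Rightarrow> int" where
  "coset_weight k M = (THE w. \<exists>g\<in>M. \<exists>n. g \<in> S_fin k n \<and> w = weight (coset_graph k n g))"

end

theory Submission
  imports Defs
begin

text \<open>
  The coefficient at \<open>x \<in> L\<close> is the number of factorizations \<open>x = a \<circ> b\<close> with \<open>a \<in> M(n)\<close>,
  \<open>b \<in> N(n)\<close>, divided by the order of \<open>H\<^sub>n\<close>.  Let \<open>U\<close> be the family of all unions of blocks of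
  \<open>[kn]\<close>, a vector space of dimension \<open>n\<close> over the field with two elements under symmetric
  difference.  Since \<open>U \<inter> gU\<close> has \<open>2\<close> to the number of components of the graph of \<open>g\<close> elements,
  the weight of \<open>g\<close> is the codimension of \<open>U \<inter> gU\<close> in \<open>U\<close>.  The dimension formula for
  \<open>U \<inter> aU\<close> and \<open>aU \<inter> xU\<close> inside \<open>aU\<close> makes the weight subadditive; if equality holds then
  \<open>U \<inter> xU \<subseteq> aU\<close>.  In that case every block fixed by \<open>x\<close> is the \<open>a\<close>-image of a block, so passing
  from \<open>n\<close> to \<open>n + 1\<close> only changes \<open>a\<close> by right multiplication with \<open>H\<^sub>n\<^sub>+\<^sub>1\<close>, and the quotient of
  the number of factorizations by the order of \<open>H\<^sub>n\<close> is unchanged.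
\<close>

section \<open>Blocks\<close>

text \<open>The guard \<open>s \<ge> 1\<close> is there because 0 lies in no block, so
  \<open>blk k 0\<close> is an unspecified number that may coincide with a block index.\<close>

definition block_unions :: "nat \<Rightarrow> nat \<Rightarrow> nat set set" where
  "block_unions k n =
     {X. X \<subseteq> {1..k * n} \<and> (\<forall>r\<in>X. \<forall>s\<ge>1. blk k s = blk k r \<longrightarrow> s \<in> X)}"

text \<open>Intended for a bijection \<open>f\<close> carrying block \<open>i\<close> onto block
  \<open>j\<close>: it realizes \<open>f\<close> on block \<open>i\<close> and moves nothing outside
  the two blocks. For \<open>i = j\<close> the first branch wins and \<open>f\<close> acts inside
  that one block.\<close>

definition swap_blocks :: "nat \<Rightarrow> nat \<Rightarrow> nat \<Rightarrow> (nat \<Rightarrow> nat) \<Rightarrow> nat \<Rightarrow> nat" where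
  "swap_blocks k i j f r =
     (if r \<in> Gam k i then f r else if r \<in> Gam k j then inv f r else r)"

lemma card_Gam: "i \<ge> 1 \<Longrightarrow> card (Gam k i) = k"
  by (cases i) (simp_all add: Gam_def)

lemma finite_Gam [simp]: "finite (Gam k i)"
  by (simp add: Gam_def)

section \<open>Unions of connected components\<close>

lemma adjacency_rtrancl_equiv: "equiv UNIV ((adjacency G)\<^sup>*)"
proof (rule equivI)
  have "sym (adjacency G)" by (auto simp: sym_def adjacency_def insert_commute)
  then show "sym ((adjacency G)\<^sup>*)" by (rule sym_rtrancl)
qed (simp_all add: refl_rtrancl trans_rtrancl)

text \<open>A vertex set closed under adjacency is a union of components. As components are nonempty
  and disjoint, the family can be read off from its union, so closed sets correspond to subsets of
  \<open>components G\<close>.\<close>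

lemma card_component_unions:
  assumes fin: "finite (verts G)" and ends: "\<And>e. e \<in> edges G \<Longrightarrow> ends G e \<subseteq> verts G"
  shows "card {Y. Y \<subseteq> verts G \<and> (\<forall>(i, j)\<in>adjacency G. i \<in> Y \<longrightarrow> j \<in> Y)} =
    2 ^ card (components G)"
proof -
  let ?R = "(adjacency G)\<^sup>*"
  let ?F = "{Y. Y \<subseteq> verts G \<and> (\<forall>(i, j)\<in>adjacency G. i \<in> Y \<longrightarrow> j \<in> Y)}"
  \<comment> \<open>The closure \<open>?R\<close> lives on the whole type; the assumption on
    endpoints keeps paths starting at a vertex inside the graph.\<close>
  have verts: "j \<in> verts G" if "(i, j) \<in> ?R" "i \<in> verts G" for i j
    using that by induction (use ends in \<open>auto simp: adjacency_def\<close>)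
  have comp_sub: "C \<subseteq> verts G" if "C \<in> components G" for C
    using that verts by (auto simp: components_def quotient_def)
  have closed: "j \<in> Y" if "Y \<in> ?F" "(i, j) \<in> ?R" "i \<in> Y" for Y i j
    using that(2,3,1) by induction auto
  have comp_step: "j \<in> C" if "C \<in> components G" "i \<in> C" "(i, j) \<in> adjacency G" for C i j
    using that by (auto simp: components_def quotient_def intro: rtrancl_into_rtrancl)
  have disj: "C = D" if "C \<in> components G" "D \<in> components G" "x \<in> C" "x \<in> D" for C D x
  proof -
    have "C \<in> UNIV // ?R" "D \<in> UNIV // ?R"
      using that by (auto simp: components_def quotient_def)
    then show ?thesis using quotient_disj[OF adjacency_rtrancl_equiv[of G]] that by blast
  qed
  have ne: "C \<noteq> {}" if "C \<in> components G" for C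
    using that by (auto simp: components_def quotient_def)
  have "bij_betw Union (Pow (components G)) ?F"
    unfolding bij_betw_def
  proof
    have "P \<subseteq> Q" if PQ: "P \<subseteq> components G" "Q \<subseteq> components G" "\<Union>P = \<Union>Q" for P Q
    proof
      fix C assume C: "C \<in> P"
      then obtain x where x: "x \<in> C" using ne PQ(1) by blast
      then obtain D where "D \<in> Q" "x \<in> D" using C PQ(3) by blast
      then show "C \<in> Q" using disj[of C D x] x C PQ by blast
    qed
    then show "inj_on Union (Pow (components G))"
      by (intro inj_onI equalityI) (auto simp del: Union_iff)
    show "Union ` Pow (components G) = ?F"
    proof
      show "Union ` Pow (components G) \<subseteq> ?F"
        using comp_sub comp_step by fastforce
      show "?F \<subseteq> Union ` Pow (components G)"
      proof
        fix Y assume Y: "Y \<in> ?F"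
        have "Y = \<Union>((\<lambda>v. ?R `` {v}) ` Y)"
          using closed[OF Y] by auto
        moreover have "(\<lambda>v. ?R `` {v}) ` Y \<subseteq> components G"
          using Y by (auto simp: components_def quotient_def)
        ultimately show "Y \<in> Union ` Pow (components G)" by blast
      qed
    qed
  qed
  then have "card ?F = card (Pow (components G))" by (simp add: bij_betw_same_card)
  moreover have "finite (components G)"
    using fin by (simp add: components_def quotient_def)
  ultimately show ?thesis by (simp add: card_Pow)
qed

section \<open>Families of sets closed under symmetric difference\<close>

text \<open>
  The dimension formula over the field with two elements: the map sending a pair to its
  symmetric difference has fibres no larger than the intersection.
\<close>

lemma card_sym_diff_closed:
  assumes C: "finite C" and sub: "A \<subseteq> C" "B \<subseteq> C"
    and closed: "\<And>X Y. X \<in> A \<Longrightarrow> Y \<in> A \<Longrightarrow> sym_diff X Y \<in> A"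
      "\<And>X Y. X \<in> B \<Longrightarrow> Y \<in> B \<Longrightarrow> sym_diff X Y \<in> B"
      "\<And>X Y. X \<in> C \<Longrightarrow> Y \<in> C \<Longrightarrow> sym_diff X Y \<in> C"
  shows "card A * card B \<le> card C * card (A \<inter> B)"
proof -
  have fin: "finite A" "finite B" using C sub finite_subset by blast+
  let ?d = "\<lambda>(X, Y). sym_diff X Y"
  have fibre: "card {p \<in> A \<times> B. ?d p = Z} \<le> card (A \<inter> B)" for Z
  proof (cases "{p \<in> A \<times> B. ?d p = Z} = {}")
    case False
    then obtain X0 Y0 where 0: "X0 \<in> A" "Y0 \<in> B" "sym_diff X0 Y0 = Z" by auto
    show ?thesis
    proof (rule card_inj_on_le)
      show "(\<lambda>p. sym_diff (fst p) X0) ` {p \<in> A \<times> B. ?d p = Z} \<subseteq> A \<inter> B"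
      proof (rule image_subsetI)
        fix p assume p: "p \<in> {p \<in> A \<times> B. ?d p = Z}"
        then have mem: "fst p \<in> A" "snd p \<in> B" and Z: "sym_diff (fst p) (snd p) = Z"
          by (auto simp: case_prod_beta)
        \<comment> \<open>Additively, \<open>X + Y = X0 + Y0\<close> gives
          \<open>X + X0 = Y + Y0\<close>, an element of both \<open>A\<close> and \<open>B\<close>.
          Translation by one fixed solution thus maps the fibre into the intersection.\<close>
        have "sym_diff (fst p) X0 = sym_diff (snd p) Y0" using Z 0(3) by blast
        then show "sym_diff (fst p) X0 \<in> A \<inter> B"
          using closed(1)[OF mem(1) 0(1)] closed(2)[OF mem(2) 0(2)] by simp
      qed
      show "inj_on (\<lambda>p. sym_diff (fst p) X0) {p \<in> A \<times> B. ?d p = Z}"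
      proof (rule inj_onI)
        fix p q assume pq: "p \<in> {p \<in> A \<times> B. ?d p = Z}" "q \<in> {p \<in> A \<times> B. ?d p = Z}"
          and eq: "sym_diff (fst p) X0 = sym_diff (fst q) X0"
        have Z: "sym_diff (fst p) (snd p) = Z" "sym_diff (fst q) (snd q) = Z"
          using pq by (simp_all add: case_prod_beta)
        have fst: "fst p = fst q" using eq by blast
        have "snd p = snd q" using Z unfolding fst by blast
        with fst show "p = q" by (simp add: prod_eq_iff)
      qed
    qed (simp add: fin)
  next
    case True
    show ?thesis unfolding True by simp
  qed
  have "A \<times> B = (\<Union>Z\<in>C. {p \<in> A \<times> B. ?d p = Z})"
    using closed(3)[OF subsetD[OF sub(1)] subsetD[OF sub(2)]] by auto
  then have "card (A \<times> B) \<le> (\<Sum>Z\<in>C. card {p \<in> A \<times> B. ?d p = Z})"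
    using card_UN_le[OF C, of "\<lambda>Z. {p \<in> A \<times> B. ?d p = Z}"] by simp
  also have "\<dots> \<le> (\<Sum>Z\<in>C. card (A \<inter> B))" by (intro sum_mono fibre)
  finally show ?thesis by (simp add: card_cartesian_product)
qed

section \<open>Arithmetic of block indices\<close>

context
  fixes k :: nat
  assumes k_ge_1: "k \<ge> 1"
begin

lemma blk_ge_1: "r \<ge> 1 \<Longrightarrow> blk k r \<ge> 1"
  using k_ge_1 by (simp add: blk_eq)

lemma mem_Gam_blk: "r \<ge> 1 \<Longrightarrow> r \<in> Gam k (blk k r)"
proof -
  assume r: "r \<ge> 1"
  have "k * ((r - 1) div k) + (r - 1) mod k = r - 1" by (rule mult_div_mod_eq)
  moreover have "(r - 1) mod k < k" using k_ge_1 by (intro mod_less_divisor) linarith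
  moreover have "k * ((r - 1) div k + 1) = k * ((r - 1) div k) + k"
    by (simp only: distrib_left mult_1_right)
  ultimately have "k * ((r - 1) div k) + 1 \<le> r \<and> r \<le> k * ((r - 1) div k + 1)"
    using r by linarith
  then show ?thesis
    unfolding blk_eq[OF k_ge_1 r] Gam_def atLeastAtMost_iff add_diff_cancel_right' .
qed

lemma mem_Gam_iff: "i \<ge> 1 \<Longrightarrow> r \<in> Gam k i \<longleftrightarrow> r \<ge> 1 \<and> blk k r = i"
  using blk_eqI[of i r k] mem_Gam_blk[of r] by (auto simp: Gam_def)

lemma Gam_nonempty: "i \<ge> 1 \<Longrightarrow> Gam k i \<noteq> {}"
  using card_Gam[of i k] k_ge_1 by auto

lemma blk_le_iff: "r \<ge> 1 \<Longrightarrow> blk k r \<le> n \<longleftrightarrow> r \<le> k * n"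
proof -
  assume r: "r \<ge> 1"
  have "blk k r \<le> n \<longleftrightarrow> (r - 1) div k < n"
    using r by (auto simp: blk_eq[OF k_ge_1 r])
  also have "\<dots> \<longleftrightarrow> r - 1 < n * k"
    using k_ge_1 by (simp add: div_less_iff_less_mult)
  finally show ?thesis using r by (auto simp: mult.commute)
qed

lemma Gam_subset: "1 \<le> i \<Longrightarrow> i \<le> n \<Longrightarrow> Gam k i \<subseteq> {1..k * n}"
  by (auto simp: mem_Gam_iff blk_le_iff[symmetric])

lemma Gam_disjoint:
  assumes "i \<ge> 1" "j \<ge> 1" "i \<noteq> j"
  shows "Gam k i \<inter> Gam k j = {}"
  unfolding disjoint_iff using assms by (auto simp: mem_Gam_iff)

section \<open>The block-preserving permutations\<close>

lemma S_inf_ge_1: "g \<in> S_inf \<Longrightarrow> g r \<ge> 1 \<longleftrightarrow> r \<ge> 1"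
  unfolding S_inf_def using permutes_in_image[of g "{1..}" r] by auto

lemma S_inf_bij: "g \<in> S_inf \<Longrightarrow> bij g"
  unfolding S_inf_def using permutes_bij by auto

lemma S_inf_comp:
  assumes "g \<in> S_inf" "h \<in> S_inf"
  shows "g \<circ> h \<in> S_inf"
proof -
  have "{x. (g \<circ> h) x \<noteq> x} \<subseteq> {x. g x \<noteq> x} \<union> {x. h x \<noteq> x}" by auto
  then show ?thesis
    using assms permutes_compose unfolding S_inf_def by (auto intro: finite_subset)
qed

lemma S_inf_inv: "g \<in> S_inf \<Longrightarrow> inv g \<in> S_inf"
proof -
  assume g: "g \<in> S_inf"
  have "{x. inv g x \<noteq> x} = {x. g x \<noteq> x}"
    using S_inf_bij[OF g] by (metis bij_inv_eq_iff)
  then show ?thesis using g permutes_inv unfolding S_inf_def by auto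
qed

lemma S_fin_subset: "S_fin k n \<subseteq> S_inf"
proof
  fix g assume "g \<in> S_fin k n"
  then have g: "g permutes {1..k * n}" by (simp add: S_fin_def)
  then have "g permutes {1..}" by (rule permutes_subset) auto
  moreover have "{x. g x \<noteq> x} \<subseteq> {1..k * n}" using g by (auto simp: permutes_def)
  ultimately show "g \<in> S_inf" by (auto simp: S_inf_def intro: finite_subset)
qed

lemma S_fin_iff: "g \<in> S_fin k n \<longleftrightarrow> g \<in> S_inf \<and> (\<forall>r. r > k * n \<longrightarrow> g r = r)"
proof
  assume "g \<in> S_fin k n"
  then show "g \<in> S_inf \<and> (\<forall>r. r > k * n \<longrightarrow> g r = r)"
    using S_fin_subset by (auto simp: S_fin_def permutes_def)
next
  assume g: "g \<in> S_inf \<and> (\<forall>r. r > k * n \<longrightarrow> g r = r)"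
  then have "g permutes {1..}" by (simp add: S_inf_def)
  then have "g permutes {1..k * n}"
    by (rule permutes_superset) (use g in auto)
  then show "g \<in> S_fin k n" by (simp add: S_fin_def)
qed

lemma S_fin_mono: "n \<le> m \<Longrightarrow> S_fin k n \<subseteq> S_fin k m"
proof -
  assume "n \<le> m"
  then have "k * n \<le> k * m" by simp
  then show ?thesis unfolding S_fin_iff subset_iff by (meson le_less_trans)
qed

lemma finite_S_fin: "finite (S_fin k n)"
  by (simp add: S_fin_def finite_permutations)

lemma S_fin_comp: "g \<in> S_fin k n \<Longrightarrow> h \<in> S_fin k n \<Longrightarrow> g \<circ> h \<in> S_fin k n"
  by (simp add: S_fin_def permutes_compose)

lemma S_fin_inv: "g \<in> S_fin k n \<Longrightarrow> inv g \<in> S_fin k n"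
  by (simp add: S_fin_def permutes_inv)

lemma S_inf_eventually_S_fin: "g \<in> S_inf \<Longrightarrow> \<exists>n. g \<in> S_fin k n"
proof -
  assume g: "g \<in> S_inf"
  then have "finite {x. g x \<noteq> x}" by (simp add: S_inf_def)
  then obtain b where b: "\<forall>x\<in>{x. g x \<noteq> x}. x \<le> b"
    using finite_nat_set_iff_bounded_le by auto
  have "b \<le> k * b" using k_ge_1 by simp
  then have "\<forall>r. r > k * b \<longrightarrow> g r = r"
    using b by (metis (mono_tags) leD le_less_trans mem_Collect_eq)
  then show ?thesis using g S_fin_iff by blast
qed

section \<open>Permutations that permute the blocks\<close>

lemma H_inf_subset: "H_inf k \<subseteq> S_inf"
  by (auto simp: H_inf_def)

lemma H_infI:
  assumes "h \<in> S_inf" "\<And>i. i \<ge> 1 \<Longrightarrow> \<exists>j\<ge>1. h ` Gam k i \<subseteq> Gam k j"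
  shows "h \<in> H_inf k"
  unfolding H_inf_def
proof (intro CollectI conjI allI impI)
  fix r s :: nat assume rs: "r \<ge> 1" "s \<ge> 1" "blk k r = blk k s"
  then obtain j where j: "j \<ge> 1" "h ` Gam k (blk k r) \<subseteq> Gam k j"
    using assms(2)[OF blk_ge_1[OF rs(1)]] by blast
  have "r \<in> Gam k (blk k r)" "s \<in> Gam k (blk k r)"
    using rs mem_Gam_blk[of r] mem_Gam_blk[of s] by simp_all
  then have "h r \<in> Gam k j" "h s \<in> Gam k j" using j(2) by blast+
  then show "blk k (h r) = blk k (h s)"
    unfolding mem_Gam_iff[OF j(1)] by simp
qed (rule assms)

text \<open>By definition of \<open>H_inf\<close> the image stays in a single block. All blocks have
  \<open>k\<close> elements, so injectivity makes it fill that block.\<close>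

lemma H_inf_image_Gam:
  assumes h: "h \<in> H_inf k" and i: "i \<ge> 1"
  obtains j where "j \<ge> 1" "h ` Gam k i = Gam k j"
proof -
  have S: "h \<in> S_inf" using h H_inf_subset by blast
  obtain r where r: "r \<in> Gam k i" using Gam_nonempty[OF i] by blast
  then have r1: "r \<ge> 1" "blk k r = i" using mem_Gam_iff[OF i] by auto
  let ?j = "blk k (h r)"
  have j: "?j \<ge> 1" using S_inf_ge_1[OF S, of r] r1 by (intro blk_ge_1) simp
  have "h ` Gam k i \<subseteq> Gam k ?j"
  proof (rule image_subsetI)
    fix s assume "s \<in> Gam k i"
    then have s: "s \<ge> 1" "blk k s = blk k r" using mem_Gam_iff[OF i] r1 by auto
    then have "blk k (h s) = blk k (h r)" using h r1(1) unfolding H_inf_def by blast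
    then show "h s \<in> Gam k ?j" using S_inf_ge_1[OF S, of s] s by (simp add: mem_Gam_iff[OF j])
  qed
  moreover have "card (h ` Gam k i) = card (Gam k ?j)"
    using card_image[of h "Gam k i"] S_inf_bij[OF S] card_Gam[OF i] card_Gam[OF j]
    by (metis bij_is_inj inj_on_subset subset_UNIV)
  ultimately have "h ` Gam k i = Gam k ?j" by (simp add: card_subset_eq)
  with j show ?thesis by (rule that)
qed

text \<open>The definition only says that elements of one block stay together. Different blocks stay
  apart because whole blocks are mapped onto whole blocks; this yields closure under
  inverses.\<close>

lemma H_inf_blk_iff:
  assumes h: "h \<in> H_inf k" and rs: "r \<ge> 1" "s \<ge> 1"
  shows "blk k (h r) = blk k (h s) \<longleftrightarrow> blk k r = blk k s"
proof
  assume eq: "blk k (h r) = blk k (h s)"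
  have S: "h \<in> S_inf" using h H_inf_subset by blast
  obtain j where j: "j \<ge> 1" "h ` Gam k (blk k r) = Gam k j"
    using H_inf_image_Gam[OF h blk_ge_1[OF rs(1)]] .
  have "h r \<in> Gam k j" using j mem_Gam_blk[OF rs(1)] by blast
  then have "h s \<in> Gam k j" using eq S_inf_ge_1[OF S, of s] rs by (simp add: mem_Gam_iff[OF j(1)])
  then have "h s \<in> h ` Gam k (blk k r)" using j by simp
  then have "s \<in> Gam k (blk k r)"
    using S_inf_bij[OF S] by (metis bij_is_inj inj_image_mem_iff)
  then show "blk k r = blk k s" using mem_Gam_iff[OF blk_ge_1[OF rs(1)]] by simp
next
  assume "blk k r = blk k s"
  then show "blk k (h r) = blk k (h s)" using h rs unfolding H_inf_def by blast
qed

lemma id_in_H_inf: "id \<in> H_inf k"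
  by (simp add: H_inf_def S_inf_def permutes_id)

lemma H_inf_comp:
  assumes g: "g \<in> H_inf k" and h: "h \<in> H_inf k"
  shows "g \<circ> h \<in> H_inf k"
proof -
  have S: "g \<in> S_inf" "h \<in> S_inf" using g h H_inf_subset by blast+
  show ?thesis
    unfolding H_inf_def
  proof (intro CollectI conjI allI impI)
    fix r s :: nat assume rs: "r \<ge> 1" "s \<ge> 1" "blk k r = blk k s"
    then have "h r \<ge> 1" "h s \<ge> 1" using S_inf_ge_1[OF S(2)] by blast+
    moreover have "blk k (h r) = blk k (h s)" using H_inf_blk_iff[OF h rs(1,2)] rs(3) by blast
    ultimately have "blk k (g (h r)) = blk k (g (h s))" using H_inf_blk_iff[OF g] by blast
    then show "blk k ((g \<circ> h) r) = blk k ((g \<circ> h) s)" by simp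
  qed (rule S_inf_comp[OF S])
qed

lemma H_inf_inv:
  assumes h: "h \<in> H_inf k"
  shows "inv h \<in> H_inf k"
proof -
  have S: "h \<in> S_inf" "inv h \<in> S_inf" using h H_inf_subset S_inf_inv by blast+
  have hi: "h (inv h r) = r" for r
    using S_inf_bij[OF S(1)] by (simp add: bij_is_surj surj_f_inv_f)
  show ?thesis
    unfolding H_inf_def
  proof (intro CollectI conjI allI impI)
    fix r s :: nat assume rs: "r \<ge> 1" "s \<ge> 1" "blk k r = blk k s"
    then have "inv h r \<ge> 1" "inv h s \<ge> 1" using S_inf_ge_1[OF S(2)] by blast+
    from H_inf_blk_iff[OF h this] show "blk k (inv h r) = blk k (inv h s)"
      using rs(3) unfolding hi by blast
  qed (rule S)
qed

lemma H_fin_subset: "H_fin k n \<subseteq> S_fin k n" "H_fin k n \<subseteq> H_inf k"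
  by (auto simp: H_fin_def)

lemma id_in_H_fin: "id \<in> H_fin k n"
  using id_in_H_inf by (simp add: H_fin_def S_fin_def permutes_id)

lemma H_fin_comp: "g \<in> H_fin k n \<Longrightarrow> h \<in> H_fin k n \<Longrightarrow> g \<circ> h \<in> H_fin k n"
  by (simp add: H_fin_def H_inf_comp S_fin_comp)

lemma H_fin_inv: "h \<in> H_fin k n \<Longrightarrow> inv h \<in> H_fin k n"
  by (simp add: H_fin_def H_inf_inv S_fin_inv)

lemma H_fin_mono: "n \<le> m \<Longrightarrow> H_fin k n \<subseteq> H_fin k m"
  unfolding H_fin_def using S_fin_mono[of n m] by blast

lemma finite_H_fin: "finite (H_fin k n)"
  using finite_S_fin by (rule finite_subset[OF H_fin_subset(1)])

lemma card_H_fin_pos: "card (H_fin k n) > 0"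
  using id_in_H_fin[of n] finite_H_fin[of n] by (auto simp: card_gt_0_iff)

section \<open>Swapping two blocks along a bijection\<close>

lemma swap_blocks_image:
  assumes f: "bij f" and ij: "1 \<le> i" "1 \<le> j" and im: "f ` Gam k i = Gam k j"
  shows "swap_blocks k i j f ` Gam k i = Gam k j"
    and "swap_blocks k i j f ` Gam k j = Gam k i"
proof -
  show 1: "swap_blocks k i j f ` Gam k i = Gam k j"
    using im by (auto simp: swap_blocks_def)
  show "swap_blocks k i j f ` Gam k j = Gam k i"
  proof (cases "i = j")
    case True
    then show ?thesis using 1 by simp
  next
    case False
    then have "Gam k i \<inter> Gam k j = {}" using Gam_disjoint ij by simp
    then have "swap_blocks k i j f ` Gam k j = inv f ` Gam k j"
      by (intro image_cong) (auto simp: swap_blocks_def)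
    also have "\<dots> = Gam k i"
      using im f by (metis bij_is_inj image_inv_f_f)
    finally show ?thesis .
  qed
qed

text \<open>The source of elements of \<open>H_fin k n\<close> with prescribed action on one block.
  The two blocks are exchanged and the rest is fixed, so \<open>{1..k * n}\<close> is mapped onto
  itself, and finiteness gives bijectivity.\<close>

lemma swap_blocks_in_H_fin:
  assumes f: "bij f" and ij: "1 \<le> i" "i \<le> n" "1 \<le> j" "j \<le> n" and im: "f ` Gam k i = Gam k j"
  shows "swap_blocks k i j f \<in> H_fin k n"
proof -
  let ?t = "swap_blocks k i j f"
  note img = swap_blocks_image[OF f ij(1,3) im]
  have sub: "Gam k i \<subseteq> {1..k * n}" "Gam k j \<subseteq> {1..k * n}"
    using ij Gam_subset by simp_all
  have out: "?t r = r" if "r \<notin> Gam k i" "r \<notin> Gam k j" for r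
    using that by (simp add: swap_blocks_def)
  have "?t ` {1..k * n} = {1..k * n}"
  proof -
    let ?R = "{1..k * n} - Gam k i - Gam k j"
    have split: "{1..k * n} = Gam k i \<union> Gam k j \<union> ?R" using sub by blast
    have R: "?t ` ?R = ?R" using out by force
    have "?t ` {1..k * n} = ?t ` (Gam k i \<union> Gam k j \<union> ?R)"
      by (rule arg_cong[OF split])
    also have "\<dots> = {1..k * n}" unfolding image_Un img R using split by blast
    finally show ?thesis .
  qed
  then have "bij_betw ?t {1..k * n} {1..k * n}"
    by (simp add: bij_betw_def eq_card_imp_inj_on)
  moreover have "?t r = r" if "r \<notin> {1..k * n}" for r
    using that sub out by blast
  ultimately have S: "?t \<in> S_fin k n"
    unfolding S_fin_def using bij_imp_permutes by blast
  have "\<exists>j'\<ge>1. ?t ` Gam k l \<subseteq> Gam k j'" if l: "l \<ge> 1" for l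
  proof (cases "l = i \<or> l = j")
    case True
    then show ?thesis using img ij by auto
  next
    case False
    then have "Gam k l \<inter> Gam k i = {}" "Gam k l \<inter> Gam k j = {}"
      using Gam_disjoint ij l by auto
    then have "?t ` Gam k l \<subseteq> Gam k l" using out by fastforce
    then show ?thesis using l by blast
  qed
  with subsetD[OF S_fin_subset S] have "?t \<in> H_inf k" by (rule H_infI)
  then show ?thesis using S by (simp add: H_fin_def)
qed

section \<open>Double cosets at a finite level\<close>

lemma mem_Gam_Suc_iff: "r \<in> Gam k (Suc n) \<longleftrightarrow> k * n < r \<and> r \<le> k * Suc n"
  by (auto simp: Gam_def)

lemma S_fin_fixes_Gam_Suc:
  assumes "g \<in> S_fin k n"
  shows "r \<in> Gam k (Suc n) \<Longrightarrow> g r = r" and "g ` Gam k (Suc n) = Gam k (Suc n)"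
proof -
  show fixed: "r \<in> Gam k (Suc n) \<Longrightarrow> g r = r" for r
    using assms by (simp add: S_fin_iff mem_Gam_Suc_iff)
  show "g ` Gam k (Suc n) = Gam k (Suc n)" using fixed by force
qed

lemma S_fin_Suc_fixing:
  assumes g: "g \<in> S_fin k (Suc n)" and fixed: "\<And>r. r \<in> Gam k (Suc n) \<Longrightarrow> g r = r"
  shows "g \<in> S_fin k n"
proof -
  have "g \<in> S_inf" "\<forall>r. r > k * Suc n \<longrightarrow> g r = r"
    using g by (simp_all add: S_fin_iff)
  then show ?thesis
    unfolding S_fin_iff using fixed mem_Gam_Suc_iff not_le by blast
qed

lemma H_fin_Suc_fixing:
  assumes "h \<in> H_fin k (Suc n)" "\<And>r. r \<in> Gam k (Suc n) \<Longrightarrow> h r = r"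
  shows "h \<in> H_fin k n"
  using assms S_fin_Suc_fixing by (simp add: H_fin_def)

lemma S_fin_bij: "g \<in> S_fin k n \<Longrightarrow> bij g"
  by (auto simp: S_fin_def permutes_bij)

lemma image_Gam_le:
  assumes "f \<in> S_fin k n" "1 \<le> i" "i \<le> n" "1 \<le> j" "f ` Gam k i = Gam k j"
  shows "j \<le> n"
proof -
  obtain r where "r \<in> Gam k i" using Gam_nonempty[OF assms(2)] by blast
  then have "f r \<in> Gam k j" "r \<in> {1..k * n}"
    using assms(5) Gam_subset[OF assms(2,3)] by blast+
  moreover from this have "f r \<in> {1..k * n}"
    using assms(1) permutes_in_image[of f "{1..k * n}" r] by (simp add: S_fin_def)
  ultimately show ?thesis
    using blk_le_iff[of "f r" n] by (simp add: mem_Gam_iff[OF assms(4)])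
qed

text \<open>
  Both outer factors are corrected by block swaps, intertwined by \<open>g\<close>, that undo the movement of
  the last block.
\<close>

lemma double_coset_descent:
  assumes g: "g \<in> S_fin k n" and g': "g' \<in> S_fin k n"
    and h: "h \<in> H_fin k (Suc n)" and h': "h' \<in> H_fin k (Suc n)" and eq: "g' = h \<circ> g \<circ> h'"
  shows "\<exists>h1\<in>H_fin k n. \<exists>h2\<in>H_fin k n. g' = h1 \<circ> g \<circ> h2"
proof -
  let ?m = "Suc n"
  have bij: "bij g" "bij h" "bij h'"
    using g h h' S_fin_bij H_fin_subset(1) by blast+
  have hS: "h \<in> H_inf k" "h' \<in> H_inf k" "h \<in> S_fin k ?m" "h' \<in> S_fin k ?m" "g \<in> S_fin k ?m"
    using h h' H_fin_subset g S_fin_mono[of n ?m] by auto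
  \<comment> \<open>Follow the last block through \<open>h \<circ> g \<circ> h'\<close>:
    \<open>h'\<close> sends it to block \<open>b\<close>, \<open>g\<close> sends \<open>b\<close> to
    \<open>b'\<close>, and \<open>h\<close> sends \<open>b'\<close> back to the last block, because
    \<open>g'\<close> fixes it.\<close>
  obtain b where b: "b \<ge> 1" "h' ` Gam k ?m = Gam k b"
    using H_inf_image_Gam[OF hS(2), of ?m] by auto
  obtain b' where b': "b' \<ge> 1" "inv h ` Gam k ?m = Gam k b'"
    using H_inf_image_Gam[OF H_inf_inv[OF hS(1)], of ?m] by auto
  have "h ` (g ` (h' ` Gam k ?m)) = Gam k ?m"
    using S_fin_fixes_Gam_Suc(2)[OF g'] by (simp add: eq image_comp)
  then have gb: "g ` Gam k b = Gam k b'"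
    using b b' bij(2) by (metis bij_is_inj image_inv_f_f)
  have bm: "b \<le> ?m" by (rule image_Gam_le[OF hS(4) _ _ b]) auto
  have b'm: "b' \<le> ?m" by (rule image_Gam_le[OF hS(5) b(1) bm b'(1) gb])
  have gm: "g ` Gam k ?m = Gam k ?m" by (rule S_fin_fixes_Gam_Suc(2)[OF g])
  \<comment> \<open>\<open>f\<close> is the conjugate of \<open>h'\<close> by \<open>g\<close>, so
    that swaps built from \<open>h'\<close> and from \<open>f\<close> correspond under
    \<open>g\<close>.\<close>
  define f where "f = g \<circ> h' \<circ> inv g"
  have fbij: "bij f" unfolding f_def using bij by (intro bij_comp bij_imp_bij_inv)
  have fg: "f (g r) = g (h' r)" for r
    by (simp add: f_def bij_is_inj[OF bij(1)])
  have ifg: "inv f (g r) = g (inv h' r)" for r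
  proof -
    have "f (g (inv h' r)) = g r"
      unfolding fg using bij(3) by (simp add: bij_is_surj surj_f_inv_f)
    then show ?thesis using fbij by (metis bij_inv_eq_iff)
  qed
  have "f ` Gam k ?m = f ` (g ` Gam k ?m)" by (simp add: gm)
  also have "\<dots> = g ` (h' ` Gam k ?m)" by (simp add: image_image fg)
  finally have fm: "f ` Gam k ?m = Gam k b'" by (simp add: b gb)
  define t1 where "t1 = swap_blocks k ?m b h'"
  define t2 where "t2 = swap_blocks k ?m b' f"
  have t1: "t1 \<in> H_fin k ?m"
    unfolding t1_def by (rule swap_blocks_in_H_fin[OF bij(3) _ _ b(1) bm b(2)]) auto
  have t2: "t2 \<in> H_fin k ?m"
    unfolding t2_def by (rule swap_blocks_in_H_fin[OF fbij _ _ b'(1) b'm fm]) auto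
  \<comment> \<open>\<open>g\<close> carries the last block to itself and block \<open>b\<close> to
    block \<open>b'\<close>, so both swaps take the same branch.\<close>
  have "t2 (g r) = g (t1 r)" for r
  proof -
    have "g r \<in> Gam k ?m \<longleftrightarrow> r \<in> Gam k ?m" "g r \<in> Gam k b' \<longleftrightarrow> r \<in> Gam k b"
      using gm gb bij(1) by (metis bij_is_inj inj_image_mem_iff)+
    then show ?thesis by (simp add: t1_def t2_def swap_blocks_def fg ifg)
  qed
  then have tg: "t2 \<circ> g = g \<circ> t1" by auto
  have bt1: "bij t1" using t1 S_fin_bij H_fin_subset(1) by blast
  \<comment> \<open>\<open>t2\<close> and \<open>inv t1\<close> cancel across \<open>g\<close>, so
    the product is unchanged. On the last block \<open>t1\<close> agrees with \<open>h'\<close>,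
    hence \<open>h2\<close> fixes that block pointwise.\<close>
  define h2 where "h2 = inv t1 \<circ> h'"
  define h1 where "h1 = h \<circ> t2"
  have "h1 \<circ> g \<circ> h2 = h \<circ> (t2 \<circ> g) \<circ> (inv t1 \<circ> h')"
    by (simp add: h1_def h2_def comp_assoc)
  also have "\<dots> = h \<circ> g \<circ> (t1 \<circ> inv t1) \<circ> h'" by (simp add: tg comp_assoc)
  also have "\<dots> = g'" using bt1 by (simp add: eq bij_is_surj surj_iff[THEN iffD1])
  finally have eq': "h1 \<circ> g \<circ> h2 = g'" .
  have h2fix: "h2 r = r" if "r \<in> Gam k ?m" for r
  proof -
    have "t1 r = h' r" using that by (simp add: t1_def swap_blocks_def)
    then show ?thesis by (simp add: h2_def bij_is_inj[OF bt1] flip: \<open>t1 r = h' r\<close>)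
  qed
  have h2: "h2 \<in> H_fin k n"
    using H_fin_comp[OF H_fin_inv[OF t1] h'] h2fix unfolding h2_def by (rule H_fin_Suc_fixing)
  \<comment> \<open>Since \<open>g'\<close>, \<open>g\<close> and \<open>h2\<close> all fix the last
    block pointwise, so does \<open>h1\<close>.\<close>
  have h1fix: "h1 r = r" if r: "r \<in> Gam k ?m" for r
  proof -
    have "h1 (g (h2 r)) = g' r" by (simp flip: eq')
    then show ?thesis
      using h2fix[OF r] S_fin_fixes_Gam_Suc(1)[OF g r] S_fin_fixes_Gam_Suc(1)[OF g' r] by simp
  qed
  have "h1 \<in> H_fin k ?m" unfolding h1_def by (rule H_fin_comp[OF h t2])
  then have "h1 \<in> H_fin k n" using h1fix by (rule H_fin_Suc_fixing)
  with h2 eq' show ?thesis by blast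
qed

text \<open>This makes each nonempty level of a double coset a single double coset of
  \<open>H_fin k n\<close>. By finite support both outer factors lie in some finite level; the
  descent lemma lowers it to \<open>n\<close> one step at a time.\<close>

lemma double_coset_fin:
  assumes x: "x \<in> S_fin k n" and y: "y \<in> S_fin k n" and xy: "y \<in> double_coset k x"
  obtains h h' where "h \<in> H_fin k n" "h' \<in> H_fin k n" "y = h \<circ> x \<circ> h'"
proof -
  obtain h h' where h: "h \<in> H_inf k" "h' \<in> H_inf k" "y = h \<circ> x \<circ> h'"
    using xy by (auto simp: double_coset_def)
  obtain p q where "h \<in> S_fin k p" "h' \<in> S_fin k q"
    using h H_inf_subset S_inf_eventually_S_fin by blast
  \<comment> \<open>The excess \<open>p + q\<close> over \<open>n\<close> is large enough for both
    factors and serves as the induction variable.\<close>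
  then have "h \<in> S_fin k (n + (p + q))" "h' \<in> S_fin k (n + (p + q))"
    using S_fin_mono[of p "n + (p + q)"] S_fin_mono[of q "n + (p + q)"] by auto
  then have "\<exists>h\<in>H_fin k (n + (p + q)). \<exists>h'\<in>H_fin k (n + (p + q)). y = h \<circ> x \<circ> h'"
    using h by (auto simp: H_fin_def)
  then have "\<exists>h\<in>H_fin k n. \<exists>h'\<in>H_fin k n. y = h \<circ> x \<circ> h'"
  proof (induction "p + q" arbitrary: p q)
    case (Suc d)
    then obtain h h' where "h \<in> H_fin k (Suc (n + d))" "h' \<in> H_fin k (Suc (n + d))" "y = h \<circ> x \<circ> h'"
      by (metis add_Suc_right)
    moreover have "x \<in> S_fin k (n + d)" "y \<in> S_fin k (n + d)"
      using x y S_fin_mono[of n "n + d"] by auto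
    ultimately show ?case
      using double_coset_descent Suc.hyps(1)[of d 0] by simp
  qed simp
  then show ?thesis using that by blast
qed

lemma double_coset_self: "x \<in> double_coset k x"
proof -
  have "x = id \<circ> x \<circ> id" by simp
  then show ?thesis unfolding double_coset_def using id_in_H_inf by blast
qed

lemma double_cosets_closed:
  assumes M: "M \<in> double_cosets k" and x: "x \<in> M" and h: "h \<in> H_inf k" "h' \<in> H_inf k"
  shows "h \<circ> x \<circ> h' \<in> M"
proof -
  obtain g where g: "M = double_coset k g" using M by (auto simp: double_cosets_def)
  obtain p q where p: "p \<in> H_inf k" "q \<in> H_inf k" "x = p \<circ> g \<circ> q"
    using x by (auto simp: g double_coset_def)
  have "h \<circ> x \<circ> h' = (h \<circ> p) \<circ> g \<circ> (q \<circ> h')" by (simp add: p comp_assoc)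
  then show ?thesis
    unfolding g double_coset_def using H_inf_comp h p by blast
qed

lemma H_inf_bij: "h \<in> H_inf k \<Longrightarrow> bij h"
  using H_inf_subset S_inf_bij by blast

lemma double_cosets_eq:
  assumes M: "M \<in> double_cosets k" and x: "x \<in> M"
  shows "M = double_coset k x"
proof
  show "double_coset k x \<subseteq> M"
    using double_cosets_closed[OF M x] by (auto simp: double_coset_def)
  obtain g where g: "M = double_coset k g" using M by (auto simp: double_cosets_def)
  obtain p q where p: "p \<in> H_inf k" "q \<in> H_inf k" "x = p \<circ> g \<circ> q"
    using x by (auto simp: g double_coset_def)
  show "M \<subseteq> double_coset k x"
  proof
    fix y assume "y \<in> M"
    then obtain u v where u: "u \<in> H_inf k" "v \<in> H_inf k" "y = u \<circ> g \<circ> v"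
      by (auto simp: g double_coset_def)
    have "(u \<circ> inv p) \<circ> x \<circ> (inv q \<circ> v) = u \<circ> (inv p \<circ> p) \<circ> g \<circ> (q \<circ> inv q) \<circ> v"
      by (simp add: p comp_assoc)
    also have "\<dots> = y"
      using p H_inf_bij by (simp add: u bij_is_inj bij_is_surj surj_iff[THEN iffD1])
    finally show "y \<in> double_coset k x"
      unfolding double_coset_def using H_inf_comp H_inf_inv p u by blast
  qed
qed

section \<open>Structure coefficients count factorizations\<close>

text \<open>A factorization \<open>x = a \<circ> b\<close> is recorded by \<open>a\<close> alone,
  which determines \<open>b\<close>.\<close>

definition left_factors ::
    "(nat \<Rightarrow> nat) set \<Rightarrow> (nat \<Rightarrow> nat) set \<Rightarrow> nat \<Rightarrow> (nat \<Rightarrow> nat) \<Rightarrow> (nat \<Rightarrow> nat) set" where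
  "left_factors M N n x = {a \<in> level k M n. inv a \<circ> x \<in> level k N n}"

lemma finite_left_factors: "finite (left_factors M N n x)"
  by (rule finite_subset[OF _ finite_S_fin[of n]]) (auto simp: left_factors_def level_def)

text \<open>From \<open>x = a \<circ> b\<close> follows \<open>h \<circ> x \<circ> h' = (h \<circ>
  a) \<circ> (b \<circ> h')\<close>, and double cosets absorb \<open>h\<close> and
  \<open>h'\<close>.\<close>

lemma left_factors_translate:
  assumes M: "M \<in> double_cosets k" and N: "N \<in> double_cosets k"
    and h: "h \<in> H_fin k n" and h': "h' \<in> H_fin k n"
    and a: "a \<in> left_factors M N n x"
  shows "h \<circ> a \<in> left_factors M N n (h \<circ> x \<circ> h')"
proof -
  have hS: "h \<in> H_inf k" "h' \<in> H_inf k" "h \<in> S_fin k n" "h' \<in> S_fin k n"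
    using h h' H_fin_subset by blast+
  have aS: "a \<in> S_fin k n" "a \<in> M" "inv a \<circ> x \<in> N" "inv a \<circ> x \<in> S_fin k n"
    using a by (simp_all add: left_factors_def level_def)
  have "h \<circ> a \<in> M" using double_cosets_closed[OF M aS(2) hS(1) id_in_H_inf] by simp
  moreover have "inv (h \<circ> a) \<circ> (h \<circ> x \<circ> h') = inv a \<circ> (inv h \<circ> h) \<circ> x \<circ> h'"
    by (simp add: o_inv_distrib[OF S_fin_bij[OF hS(3)] S_fin_bij[OF aS(1)]] comp_assoc)
  then have eq: "inv (h \<circ> a) \<circ> (h \<circ> x \<circ> h') = (inv a \<circ> x) \<circ> h'"
    by (simp add: bij_is_inj[OF S_fin_bij[OF hS(3)]])
  moreover have "(inv a \<circ> x) \<circ> h' \<in> N"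
    using double_cosets_closed[OF N aS(3) id_in_H_inf hS(2)] by simp
  ultimately show ?thesis
    unfolding left_factors_def level_def eq mem_Collect_eq
    using S_fin_comp hS aS by blast
qed

lemma card_left_factors_le:
  assumes "M \<in> double_cosets k" "N \<in> double_cosets k" "h \<in> H_fin k n" "h' \<in> H_fin k n"
  shows "card (left_factors M N n x) \<le> card (left_factors M N n (h \<circ> x \<circ> h'))"
proof (rule card_inj_on_le)
  have "inj h" using assms(3) H_fin_subset(2) H_inf_bij bij_is_inj by blast
  then show "inj_on (\<lambda>a. h \<circ> a) (left_factors M N n x)"
    by (intro inj_onI) (simp add: fun.inj_map_strong inj_eq fun_eq_iff)
  show "(\<lambda>a. h \<circ> a) ` left_factors M N n x \<subseteq> left_factors M N n (h \<circ> x \<circ> h')"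
    using left_factors_translate[OF assms] by blast
qed (rule finite_left_factors)

text \<open>Each of \<open>x\<close> and \<open>y\<close> is a translate of the other by factors
  from \<open>H_fin k n\<close>, so the inequality for translates applies in both
  directions.\<close>

lemma card_left_factors_cong:
  assumes M: "M \<in> double_cosets k" and N: "N \<in> double_cosets k" and L: "L \<in> double_cosets k"
    and x: "x \<in> level k L n" and y: "y \<in> level k L n"
  shows "card (left_factors M N n x) = card (left_factors M N n y)"
proof -
  have "card (left_factors M N n x) \<le> card (left_factors M N n y)"
    if x: "x \<in> level k L n" and y: "y \<in> level k L n" for x y
  proof -
    have "x \<in> S_fin k n" "y \<in> S_fin k n" "y \<in> double_coset k x"
      using x y double_cosets_eq[OF L] by (auto simp: level_def)
    then obtain h h' where "h \<in> H_fin k n" "h' \<in> H_fin k n" "y = h \<circ> x \<circ> h'"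
      by (rule double_coset_fin)
    then show ?thesis using card_left_factors_le[OF M N] by simp
  qed
  then show ?thesis using x y by (simp add: antisym)
qed

section \<open>The Hecke product and its expansion coefficients\<close>

lemma finite_level: "finite (level k M n)"
  unfolding level_def using finite_S_fin by simp

lemma S_elt_eq: "S_elt k M n x = (if x \<in> level k M n then 1 / of_nat (card (H_fin k n)) else 0)"
  using finite_level[of M n] by (simp add: S_elt_def basis_elt_def)

text \<open>The convolution runs over factorizations of \<open>x\<close>, reindexed by the left
  factor. Each one with factors in \<open>M\<close> and \<open>N\<close> contributes the square of
  \<open>1 / card (H_fin k n)\<close>.\<close>

lemma galg_mult_S_elt:
  assumes x: "x \<in> S_fin k n"
  shows "galg_mult k n (S_elt k M n) (S_elt k N n) x =
    of_nat (card (left_factors M N n x)) / of_nat (card (H_fin k n)) ^ 2"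
proof -
  let ?c = "of_nat (card (H_fin k n)) :: complex"
  have "galg_mult k n (S_elt k M n) (S_elt k N n) x =
      (\<Sum>a\<in>S_fin k n. S_elt k M n a * S_elt k N n (inv a \<circ> x))"
    unfolding galg_mult_def
  proof (rule sum.reindex_bij_witness[where j = fst and i = "\<lambda>a. (a, inv a \<circ> x)"])
    fix p assume "p \<in> {(a, b). a \<in> S_fin k n \<and> b \<in> S_fin k n \<and> a \<circ> b = x}"
    then obtain a b where p: "p = (a, b)" "a \<in> S_fin k n" "a \<circ> b = x" by auto
    have "inv a \<circ> x = (inv a \<circ> a) \<circ> b" using p(3) by (auto simp: comp_assoc)
    then have "inv a \<circ> x = b" using bij_is_inj[OF S_fin_bij[OF p(2)]] by simp
    with p show "(fst p, inv (fst p) \<circ> x) = p" "fst p \<in> S_fin k n"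
      "S_elt k M n (fst p) * S_elt k N n (inv (fst p) \<circ> x) =
        (case p of (a, b) \<Rightarrow> S_elt k M n a * S_elt k N n b)"
      by simp_all
  next
    fix a assume a: "a \<in> S_fin k n"
    have "a \<circ> (inv a \<circ> x) = (a \<circ> inv a) \<circ> x" by (simp only: comp_assoc)
    also have "\<dots> = x"
      using surj_iff[THEN iffD1, OF bij_is_surj[OF S_fin_bij[OF a]]] by simp
    finally show "(a, inv a \<circ> x) \<in> {(a, b). a \<in> S_fin k n \<and> b \<in> S_fin k n \<and> a \<circ> b = x}"
      using a S_fin_comp[OF S_fin_inv[OF a] x] by simp
  qed simp
  also have "\<dots> = (\<Sum>a\<in>S_fin k n. if a \<in> left_factors M N n x then 1 / ?c ^ 2 else 0)"
    by (rule sum.cong) (auto simp: S_elt_eq left_factors_def power2_eq_square)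
  also have "\<dots> = (\<Sum>a\<in>S_fin k n \<inter> left_factors M N n x. 1 / ?c ^ 2)"
    by (rule sum.inter_restrict[OF finite_S_fin, symmetric])
  also have "S_fin k n \<inter> left_factors M N n x = left_factors M N n x"
    by (auto simp: left_factors_def level_def)
  finally show ?thesis by simp
qed

lemma galg_mult_outside:
  assumes "x \<notin> S_fin k n"
  shows "galg_mult k n \<alpha> \<beta> x = 0"
proof -
  have empty: "{(a, b). a \<in> S_fin k n \<and> b \<in> S_fin k n \<and> a \<circ> b = x} = {}"
    using assms S_fin_comp by blast
  show ?thesis unfolding galg_mult_def empty by simp
qed

lemma double_coset_in_index_set: "x \<in> S_fin k n \<Longrightarrow> double_coset k x \<in> index_set k n"
  using S_fin_subset[of n] double_coset_self[of x]
  by (auto simp: index_set_def double_cosets_def level_def)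

lemma index_setD:
  assumes "L \<in> index_set k n" "x \<in> level k L n"
  shows "L = double_coset k x" "x \<in> S_fin k n"
  using assms double_cosets_eq[of L x] by (auto simp: index_set_def level_def)

lemma finite_index_set: "finite (index_set k n)"
proof (rule finite_subset)
  show "index_set k n \<subseteq> double_coset k ` S_fin k n"
  proof
    fix L assume L: "L \<in> index_set k n"
    then obtain x where "x \<in> level k L n" by (auto simp: index_set_def)
    from index_setD[OF L this] show "L \<in> double_coset k ` S_fin k n" by blast
  qed
qed (simp add: finite_S_fin)

text \<open>Distinct double cosets are disjoint, so only the double coset of \<open>x\<close>
  contributes at \<open>x\<close>.\<close>

lemma expansion_rhs:
  "(\<Sum>L\<in>index_set k n. c L * S_elt k L n x) =
     (if x \<in> S_fin k n then c (double_coset k x) / of_nat (card (H_fin k n)) else 0)"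
proof (cases "x \<in> S_fin k n")
  case True
  have "x \<in> level k L n \<longleftrightarrow> L = double_coset k x" if "L \<in> index_set k n" for L
    using index_setD(1)[OF that] True double_coset_self[of x] by (auto simp: level_def)
  then have "(\<Sum>L\<in>index_set k n. c L * S_elt k L n x) =
      (\<Sum>L\<in>index_set k n. if L = double_coset k x
         then c (double_coset k x) / of_nat (card (H_fin k n)) else 0)"
    by (intro sum.cong) (auto simp: S_elt_eq)
  then show ?thesis
    using True double_coset_in_index_set[OF True] finite_index_set by simp
next
  case False
  then have "S_elt k L n x = 0" for L by (simp add: S_elt_eq level_def)
  with False show ?thesis by simp
qed

lemma struct_coeff_eq:
  assumes M: "M \<in> double_cosets k" and N: "N \<in> double_cosets k" and L: "L \<in> double_cosets k"
    and x: "x \<in> level k L n"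
  shows "struct_coeff k M N L n =
    of_nat (card (left_factors M N n x)) / of_nat (card (H_fin k n))"
proof -
  let ?c = "of_nat (card (H_fin k n)) :: complex"
  have c0: "?c \<noteq> 0" using card_H_fin_pos[of n] by simp
  have Lx: "L = double_coset k x" "x \<in> S_fin k n"
    using double_cosets_eq[OF L] x by (auto simp: level_def)
  show ?thesis
    unfolding struct_coeff_def
  proof (rule the_equality)
    \<comment> \<open>Existence: count at some representative of \<open>K\<close>; by
      \<open>card_left_factors_cong\<close> the choice does not matter.\<close>
    define c where "c K = of_nat (card (left_factors M N n (SOME y. y \<in> level k K n))) / ?c" for K
    have c: "c (double_coset k y) = of_nat (card (left_factors M N n y)) / ?c"
      if "y \<in> S_fin k n" for y
    proof -
      have y: "y \<in> level k (double_coset k y) n"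
        using that double_coset_self by (simp add: level_def)
      moreover have "double_coset k y \<in> double_cosets k"
        using that S_fin_subset by (auto simp: double_cosets_def)
      ultimately show ?thesis
        unfolding c_def using card_left_factors_cong[OF M N _ someI[of "\<lambda>z. z \<in> _", OF y] y] by simp
    qed
    have "is_expansion k M N n c"
      unfolding is_expansion_def
    proof
      fix y
      show "galg_mult k n (S_elt k M n) (S_elt k N n) y = (\<Sum>L\<in>index_set k n. c L * S_elt k L n y)"
        unfolding expansion_rhs
        by (simp add: galg_mult_S_elt galg_mult_outside c power2_eq_square)
    qed
    then show "\<exists>c. is_expansion k M N n c \<and>
        of_nat (card (left_factors M N n x)) / ?c = c L"
      using c[OF Lx(2)] Lx(1) by (intro exI[of _ c]) simp
  next
    fix z assume "\<exists>c. is_expansion k M N n c \<and> z = c L"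
    then obtain c where c: "is_expansion k M N n c" "z = c L" by blast
    \<comment> \<open>Uniqueness: evaluating an expansion at \<open>x\<close> isolates the
      coefficient of \<open>L\<close>.\<close>
    from fun_cong[OF c(1)[unfolded is_expansion_def], of x]
    have "of_nat (card (left_factors M N n x)) / ?c ^ 2 = c L / ?c"
      unfolding expansion_rhs by (simp add: galg_mult_S_elt Lx)
    then show "z = of_nat (card (left_factors M N n x)) / ?c"
      using c0 c(2) by (simp add: field_simps power2_eq_square)
  qed
qed

section \<open>Weights through common unions of blocks\<close>

definition common_unions :: "nat \<Rightarrow> (nat \<Rightarrow> nat) \<Rightarrow> nat set set" where
  "common_unions n g = block_unions k n \<inter> image g ` block_unions k n"

lemma finite_block_unions: "finite (block_unions k n)"
  by (rule finite_subset[of _ "Pow {1..k * n}"]) (auto simp: block_unions_def)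

lemma finite_common_unions: "finite (common_unions n g)"
  by (simp add: common_unions_def finite_block_unions)

text \<open>Block indices are the vertices of \<open>coset_graph\<close>, so this translates between
  vertex sets and unions of blocks.\<close>

lemma block_unions_bij:
  "bij_betw (\<lambda>Y. {r. r \<ge> 1 \<and> blk k r \<in> Y}) (Pow {1..n}) (block_unions k n)"
proof (rule bij_betw_byWitness[where f' = "\<lambda>X. blk k ` X"])
  let ?U = "\<lambda>Y. {r. r \<ge> 1 \<and> blk k r \<in> Y}"
  show "\<forall>Y\<in>Pow {1..n}. blk k ` ?U Y = Y"
  proof
    fix Y assume Y: "Y \<in> Pow {1..n}"
    have "\<exists>r\<ge>1. blk k r = i" if "i \<in> Y" for i
    proof -
      have i: "i \<ge> 1" using that Y by auto
      obtain r where "r \<in> Gam k i" using Gam_nonempty[OF i] by blast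
      then show ?thesis unfolding mem_Gam_iff[OF i] by blast
    qed
    then show "blk k ` ?U Y = Y" by blast
  qed
  show "\<forall>X\<in>block_unions k n. ?U (blk k ` X) = X"
  proof
    fix X assume "X \<in> block_unions k n"
    then have "X \<subseteq> {1..k * n}" "\<forall>r\<in>X. \<forall>s\<ge>1. blk k s = blk k r \<longrightarrow> s \<in> X"
      by (simp_all add: block_unions_def)
    then show "?U (blk k ` X) = X" by auto
  qed
  show "?U ` Pow {1..n} \<subseteq> block_unions k n"
  proof (rule image_subsetI)
    fix Y assume "Y \<in> Pow {1..n}"
    then have "?U Y \<subseteq> {1..k * n}" using blk_le_iff[of _ n] by auto
    then show "?U Y \<in> block_unions k n" by (simp add: block_unions_def)
  qed
  show "(\<lambda>X. blk k ` X) ` block_unions k n \<subseteq> Pow {1..n}"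
  proof (rule image_subsetI, unfold Pow_iff, rule image_subsetI)
    fix X r assume "X \<in> block_unions k n" "r \<in> X"
    then have "r \<in> {1..k * n}" by (auto simp: block_unions_def)
    then show "blk k r \<in> {1..n}" using blk_le_iff[of r n] blk_ge_1[of r] by simp
  qed
qed

lemma card_block_unions: "card (block_unions k n) = 2 ^ n"
  using bij_betw_same_card[OF block_unions_bij[of n]] by (simp add: card_Pow)

lemma S_fin_mem_iff: "g \<in> S_fin k n \<Longrightarrow> g r \<in> {1..k * n} \<longleftrightarrow> r \<in> {1..k * n}"
  by (rule permutes_in_image) (simp add: S_fin_def)

lemma S_fin_image_subset: "g \<in> S_fin k n \<Longrightarrow> X \<subseteq> {1..k * n} \<Longrightarrow> g ` X \<subseteq> {1..k * n}"
  using S_fin_mem_iff[of g n] by fast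

lemma coset_graph_ends:
  assumes g: "g \<in> S_fin k n" and e: "e \<in> edges (coset_graph k n g)"
  shows "ends (coset_graph k n g) e \<subseteq> verts (coset_graph k n g)"
proof -
  obtain u where u: "1 \<le> u" "u \<le> n" "e \<subseteq> Gam k u" using e by (auto simp: coset_graph_def)
  have "blk k (inv g r) \<in> {1..n}" if "r \<in> e" for r
  proof -
    have "r \<in> {1..k * n}" using that u Gam_subset[OF u(1,2)] by blast
    then have "inv g r \<in> {1..k * n}" using S_fin_mem_iff[OF S_fin_inv[OF g]] by blast
    then show ?thesis using blk_le_iff[of "inv g r" n] blk_ge_1[of "inv g r"] by simp
  qed
  then show ?thesis by (auto simp: coset_graph_def)
qed

text \<open>An edge comes from two points \<open>r\<close>, \<open>s\<close> of one block and joins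
  the blocks of \<open>inv g r\<close> and \<open>inv g s\<close>. So an edge leaving
  \<open>Y\<close> witnesses a block that the image covers only partly, and conversely.\<close>

lemma image_block_union_iff:
  assumes g: "g \<in> S_fin k n" and Y: "Y \<subseteq> {1..n}"
  shows "g ` {r. r \<ge> 1 \<and> blk k r \<in> Y} \<in> block_unions k n \<longleftrightarrow>
    (\<forall>(i, j)\<in>adjacency (coset_graph k n g). i \<in> Y \<longrightarrow> j \<in> Y)"
proof -
  let ?X = "{r. r \<ge> 1 \<and> blk k r \<in> Y}"
  have gS: "g \<in> S_inf" using g S_fin_subset by blast
  have mem: "r \<in> g ` ?X \<longleftrightarrow> r \<ge> 1 \<and> blk k (inv g r) \<in> Y" for r
  proof -
    have "r \<in> g ` ?X \<longleftrightarrow> inv g r \<in> ?X"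
      unfolding bij_image_Collect_eq[OF S_fin_bij[OF g]] by simp
    then show ?thesis using S_inf_ge_1[OF S_inf_inv[OF gS], of r] by simp
  qed
  have sub: "g ` ?X \<subseteq> {1..k * n}"
  proof (rule S_fin_image_subset[OF g])
    show "?X \<subseteq> {1..k * n}" using Y blk_le_iff[of _ n] by auto
  qed
  have adj: "(i, j) \<in> adjacency (coset_graph k n g) \<longleftrightarrow>
      (\<exists>e. card e = 2 \<and> (\<exists>u\<in>{1..n}. e \<subseteq> Gam k u) \<and> (\<lambda>r. blk k (inv g r)) ` e = {i, j})" for i j
    by (auto simp: adjacency_def coset_graph_def)
  show ?thesis
  proof
    assume union: "g ` ?X \<in> block_unions k n"
    show "\<forall>(i, j)\<in>adjacency (coset_graph k n g). i \<in> Y \<longrightarrow> j \<in> Y"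
    proof (clarify)
      fix i j assume "(i, j) \<in> adjacency (coset_graph k n g)" and i: "i \<in> Y"
      then obtain e u where e: "1 \<le> u" "e \<subseteq> Gam k u" "(\<lambda>r. blk k (inv g r)) ` e = {i, j}"
        unfolding adj by auto
      have "i \<in> (\<lambda>r. blk k (inv g r)) ` e" "j \<in> (\<lambda>r. blk k (inv g r)) ` e"
        unfolding e(3) by simp_all
      then obtain r s where rs: "r \<in> e" "i = blk k (inv g r)" "s \<in> e" "j = blk k (inv g s)"
        by blast
      then have ge: "r \<ge> 1" "blk k r = u" "s \<ge> 1" "blk k s = u"
        using e(2) mem_Gam_iff[OF e(1)] by blast+
      have "r \<in> g ` ?X" unfolding mem using ge rs i by simp
      then have "s \<in> g ` ?X" using union ge unfolding block_unions_def by blast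
      then show "j \<in> Y" unfolding mem using rs by simp
    qed
  next
    assume closed: "\<forall>(i, j)\<in>adjacency (coset_graph k n g). i \<in> Y \<longrightarrow> j \<in> Y"
    have "s \<in> g ` ?X" if r: "r \<in> g ` ?X" and s: "s \<ge> 1" "blk k s = blk k r" for r s
    \<comment> \<open>Edges come from two-element sets, so only distinct points of a block give
      one.\<close>
    proof (cases "r = s")
      case False
      let ?u = "blk k r"
      have r1: "r \<ge> 1" "r \<le> k * n" using sub r by auto
      then have u: "?u \<in> {1..n}" using blk_ge_1 blk_le_iff by simp
      have "{r, s} \<subseteq> Gam k ?u" using mem_Gam_blk[OF r1(1)] mem_Gam_blk[OF s(1)] s(2) by simp
      moreover have "card {r, s} = 2" using False by simp
      ultimately have "(blk k (inv g r), blk k (inv g s)) \<in> adjacency (coset_graph k n g)"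
        unfolding adj using u by (intro exI[of _ "{r, s}"]) auto
      then show ?thesis using closed r s unfolding mem by blast
    qed (use r in simp)
    then show "g ` ?X \<in> block_unions k n" unfolding block_unions_def using sub by blast
  qed
qed

text \<open>Via \<open>V\<close> the common unions correspond to the adjacency-closed vertex sets,
  which are the unions of components.\<close>

lemma card_common_unions:
  assumes g: "g \<in> S_fin k n"
  shows "card (common_unions n g) = 2 ^ card (components (coset_graph k n g))"
proof -
  let ?U = "\<lambda>Y. {r. r \<ge> 1 \<and> blk k r \<in> Y}"
  let ?F = "{Y. Y \<subseteq> {1..n} \<and> (\<forall>(i, j)\<in>adjacency (coset_graph k n g). i \<in> Y \<longrightarrow> j \<in> Y)}"
  have verts: "verts (coset_graph k n g) = {1..n}" by (simp add: coset_graph_def)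
  define V where "V = (\<lambda>Y. g ` ?U Y)"
  have "image g ` block_unions k n = V ` Pow {1..n}"
    unfolding V_def bij_betw_imp_surj_on[OF block_unions_bij, symmetric] by (rule image_image)
  then have "common_unions n g = {Z \<in> V ` Pow {1..n}. Z \<in> block_unions k n}"
    by (auto simp: common_unions_def)
  also have "\<dots> = V ` {Y \<in> Pow {1..n}. V Y \<in> block_unions k n}" by auto
  also have "{Y \<in> Pow {1..n}. V Y \<in> block_unions k n} = ?F"
    unfolding V_def Pow_iff using image_block_union_iff[OF g] by (intro Collect_cong conj_cong) simp_all
  finally have "common_unions n g = V ` ?F" .
  moreover have "inj_on V ?F"
  proof (rule inj_onI)
    fix Y Z assume YZ: "Y \<in> ?F" "Z \<in> ?F" "V Y = V Z"
    then have eq: "?U Y = ?U Z"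
      unfolding V_def by (simp only: inj_image_eq_iff[OF bij_is_inj[OF S_fin_bij[OF g]]])
    show "Y = Z"
      by (rule inj_onD[OF bij_betw_imp_inj_on[OF block_unions_bij[of n]] eq]) (use YZ in simp_all)
  qed
  ultimately have "card (common_unions n g) = card ?F" by (simp add: card_image)
  also have "\<dots> = 2 ^ card (components (coset_graph k n g))"
    using card_component_unions[of "coset_graph k n g"] coset_graph_ends[OF g]
    by (simp add: verts)
  finally show ?thesis .
qed

section \<open>Independence of the weight from representative and level\<close>

lemma H_fin_image_block_unions:
  assumes h: "h \<in> H_fin k n"
  shows "image h ` block_unions k n = block_unions k n"
proof -
  have sub: "image h ` block_unions k n \<subseteq> block_unions k n" if h: "h \<in> H_fin k n" for h
  proof (rule image_subsetI)
    fix X assume X: "X \<in> block_unions k n"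
    have hS: "h \<in> S_fin k n" "h \<in> H_inf k" using h H_fin_subset by blast+
    have hS': "h \<in> S_inf" using hS H_inf_subset by blast
    have "h ` X \<subseteq> {1..k * n}"
      using X S_fin_image_subset[OF hS(1)] by (simp add: block_unions_def)
    moreover have "s \<in> h ` X" if r: "r \<in> h ` X" and s: "s \<ge> 1" "blk k s = blk k r" for r s
    proof -
      obtain r' where r': "r' \<in> X" "r = h r'" using r by blast
      obtain s' where s': "s = h s'" using S_inf_bij[OF hS'] by (metis bij_pointE)
      have "r' \<ge> 1" "s' \<ge> 1"
        using X r' s s' S_inf_ge_1[OF hS', of s'] by (auto simp: block_unions_def)
      then have "blk k s' = blk k r'" using s r' s' H_inf_blk_iff[OF hS(2)] by blast
      then have "s' \<in> X" using X r'(1) \<open>s' \<ge> 1\<close> unfolding block_unions_def by blast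
      then show ?thesis using s' by blast
    qed
    ultimately show "h ` X \<in> block_unions k n" unfolding block_unions_def by blast
  qed
  have "card (image h ` block_unions k n) = card (block_unions k n)"
  proof (rule card_image)
    have "inj h" using h H_fin_subset(1) S_fin_bij bij_is_inj by blast
    then show "inj_on (image h) (block_unions k n)"
      by (simp add: inj_on_def inj_image_eq_iff)
  qed
  then show ?thesis using sub[OF h] finite_block_unions by (simp add: card_subset_eq)
qed

lemma image_image_comp: "image (g \<circ> h) ` \<U> = image g ` (image h ` \<U>)"
  by (simp add: image_image image_comp comp_def)

text \<open>Both \<open>h\<close> and \<open>h'\<close> preserve the family \<open>U\<close> of
  block unions, hence \<open>U \<inter> hgh'U = h(U \<inter> gU)\<close>.\<close>

lemma card_common_unions_translate:
  assumes "h \<in> H_fin k n" "h' \<in> H_fin k n"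
  shows "card (common_unions n (h \<circ> g \<circ> h')) = card (common_unions n g)"
proof -
  let ?B = "block_unions k n"
  have "inj h" using assms(1) H_fin_subset(1) S_fin_bij bij_is_inj by blast
  then have inj: "inj (image h)" by (simp add: inj_def inj_image_eq_iff)
  have "common_unions n (h \<circ> g \<circ> h') = ?B \<inter> image h ` (image g ` ?B)"
    by (simp only: common_unions_def image_image_comp H_fin_image_block_unions[OF assms(2)])
  also have "\<dots> = image h ` ?B \<inter> image h ` (image g ` ?B)"
    by (simp only: H_fin_image_block_unions[OF assms(1)])
  also have "\<dots> = image h ` common_unions n g"
    by (simp only: common_unions_def image_Int[OF inj])
  finally show ?thesis using inj by (simp add: card_image inj_on_subset)
qed

lemma block_unions_Suc:
  "block_unions k (Suc n) = block_unions k n \<union> (\<lambda>X. X \<union> Gam k (Suc n)) ` block_unions k n"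
proof -
  let ?U = "\<lambda>Y. {r. r \<ge> 1 \<and> blk k r \<in> Y}"
  have img: "block_unions k n = ?U ` Pow {1..n}" for n
    using block_unions_bij[of n] by (simp add: bij_betw_def)
  have "?U (insert (Suc n) Y) = ?U Y \<union> Gam k (Suc n)" for Y
    using mem_Gam_iff[of "Suc n"] by auto
  then have "(\<lambda>X. X \<union> Gam k (Suc n)) ` ?U ` Pow {1..n} = ?U ` insert (Suc n) ` Pow {1..n}"
    by (simp add: image_image)
  moreover have "{1..Suc n} = insert (Suc n) {1..n}" by auto
  ultimately show ?thesis
    unfolding img by (simp only: Pow_insert image_Un)
qed

text \<open>Since \<open>g\<close> fixes the last block, each common union at level \<open>n\<close>
  extends in exactly two ways, without or with that block. In the graph, the new vertex is a
  component of its own.\<close>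

lemma card_common_unions_Suc:
  assumes g: "g \<in> S_fin k n"
  shows "card (common_unions (Suc n) g) = 2 * card (common_unions n g)"
proof -
  let ?G = "Gam k (Suc n)"
  let ?B = "block_unions k n"
  have disj: "X \<inter> ?G = {}" if "X \<in> ?B \<union> image g ` ?B" for X
  proof -
    have "X \<subseteq> {1..k * n}"
      using that S_fin_image_subset[OF g] by (auto simp: block_unions_def)
    then show ?thesis using mem_Gam_Suc_iff[of _ n] by fastforce
  qed
  have "image g ` block_unions k (Suc n) = image g ` ?B \<union> (\<lambda>X. X \<union> ?G) ` image g ` ?B"
    unfolding block_unions_Suc image_Un image_image by (simp add: image_Un S_fin_fixes_Gam_Suc(2)[OF g])
  then have split: "common_unions (Suc n) g =
      (?B \<union> (\<lambda>X. X \<union> ?G) ` ?B) \<inter> (image g ` ?B \<union> (\<lambda>X. X \<union> ?G) ` image g ` ?B)"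
    by (simp only: common_unions_def block_unions_Suc)
  have ne: "?G \<noteq> {}" using Gam_nonempty by simp
  \<comment> \<open>Level-\<open>n\<close> sets avoid the last block, so adding it is injective and
    never leads back to a level-\<open>n\<close> set.\<close>
  have cancel: "X = X'" if "X \<union> ?G = X' \<union> ?G" "X \<in> ?B \<union> image g ` ?B" "X' \<in> ?B \<union> image g ` ?B" for X X'
    using that(1) disj[OF that(2)] disj[OF that(3)] by blast
  have sep: "X \<noteq> X' \<union> ?G" if "X \<in> ?B \<union> image g ` ?B" for X X'
    using disj[OF that] ne by blast
  have eq: "common_unions (Suc n) g = common_unions n g \<union> (\<lambda>X. X \<union> ?G) ` common_unions n g"
  proof
    show "common_unions (Suc n) g \<subseteq> common_unions n g \<union> (\<lambda>X. X \<union> ?G) ` common_unions n g"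
    proof
      fix Z assume "Z \<in> common_unions (Suc n) g"
      then have "Z \<in> ?B \<or> (\<exists>X\<in>?B. Z = X \<union> ?G)" "Z \<in> image g ` ?B \<or> (\<exists>X\<in>image g ` ?B. Z = X \<union> ?G)"
        unfolding split by blast+
      then consider "Z \<in> ?B" "Z \<in> image g ` ?B" | X X' where "X \<in> ?B" "Z = X \<union> ?G" "X' \<in> image g ` ?B" "Z = X' \<union> ?G"
        using sep by blast
      then show "Z \<in> common_unions n g \<union> (\<lambda>X. X \<union> ?G) ` common_unions n g"
      proof cases
        case 2
        then have "X = X'" using cancel[of X X'] by simp
        then show ?thesis using 2 unfolding common_unions_def by blast
      qed (simp add: common_unions_def)
    qed
    show "common_unions n g \<union> (\<lambda>X. X \<union> ?G) ` common_unions n g \<subseteq> common_unions (Suc n) g"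
      unfolding split unfolding common_unions_def by blast
  qed
  have "card ((\<lambda>X. X \<union> ?G) ` common_unions n g) = card (common_unions n g)"
    by (rule card_image, rule inj_onI, rule cancel) (simp_all add: common_unions_def)
  moreover have "common_unions n g \<inter> (\<lambda>X. X \<union> ?G) ` common_unions n g = {}"
    using sep unfolding common_unions_def by blast
  ultimately show ?thesis
    unfolding eq by (simp add: card_Un_disjoint finite_common_unions)
qed

lemma weight_eq:
  assumes "g \<in> S_fin k n"
  obtains c where "card (common_unions n g) = 2 ^ c" "weight (coset_graph k n g) = int n - int c"
proof
  show "weight (coset_graph k n g) = int n - int (card (components (coset_graph k n g)))"
    by (simp add: weight_def coset_graph_def)
qed (rule card_common_unions[OF assms])

text \<open>Each step up raises both the number of vertices and the exponent in
  \<open>weight_eq\<close> by one.\<close>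

lemma weight_level_indep:
  assumes "n \<le> m" "g \<in> S_fin k n"
  shows "weight (coset_graph k m g) = weight (coset_graph k n g)"
  using assms
proof (induction m rule: dec_induct)
  case (step m)
  have g: "g \<in> S_fin k m" "g \<in> S_fin k (Suc m)"
    using step S_fin_mono[of n m] S_fin_mono[of n "Suc m"] by auto
  obtain c where c: "card (common_unions m g) = 2 ^ c" "weight (coset_graph k m g) = int m - int c"
    by (rule weight_eq[OF g(1)])
  obtain d where d: "card (common_unions (Suc m) g) = 2 ^ d"
      "weight (coset_graph k (Suc m) g) = int (Suc m) - int d"
    by (rule weight_eq[OF g(2)])
  have "(2::nat) ^ d = 2 ^ Suc c" using card_common_unions_Suc[OF g(1)] c d by simp
  then have "d = Suc c" by (rule power_inject_exp[THEN iffD1, rotated]) simp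
  then show ?case using c d step by simp
qed simp

text \<open>Two representatives are compared at the common level \<open>max n m\<close>, where they
  differ by factors from \<open>H_fin\<close>; these preserve the number of common unions.\<close>

lemma coset_weight_eq:
  assumes M: "M \<in> double_cosets k" and g: "g \<in> level k M n"
  shows "coset_weight k M = weight (coset_graph k n g)"
  unfolding coset_weight_def
proof (rule the_equality)
  show "\<exists>g'\<in>M. \<exists>m. g' \<in> S_fin k m \<and> weight (coset_graph k n g) = weight (coset_graph k m g')"
    using g by (auto simp: level_def)
next
  fix w assume "\<exists>g'\<in>M. \<exists>m. g' \<in> S_fin k m \<and> w = weight (coset_graph k m g')"
  then obtain g' m where g': "g' \<in> M" "g' \<in> S_fin k m" "w = weight (coset_graph k m g')" by blast
  let ?l = "max n m"
  have gS: "g \<in> S_fin k n" "g \<in> S_fin k ?l" "g' \<in> S_fin k ?l"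
    using g g' S_fin_mono[of n ?l] S_fin_mono[of m ?l] by (auto simp: level_def)
  have "g' \<in> double_coset k g" using g g' double_cosets_eq[OF M] by (auto simp: level_def)
  then obtain h h' where h: "h \<in> H_fin k ?l" "h' \<in> H_fin k ?l" "g' = h \<circ> g \<circ> h'"
    by (rule double_coset_fin[OF gS(2,3)])
  obtain c where c: "card (common_unions ?l g) = 2 ^ c" "weight (coset_graph k ?l g) = int ?l - int c"
    by (rule weight_eq[OF gS(2)])
  obtain d where d: "card (common_unions ?l g') = 2 ^ d" "weight (coset_graph k ?l g') = int ?l - int d"
    by (rule weight_eq[OF gS(3)])
  have "(2::nat) ^ c = 2 ^ d" using card_common_unions_translate[OF h(1,2), of g] c d h(3) by simp
  then have "c = d" by simp
  then show "w = weight (coset_graph k n g)"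
    using c(2) d(2) g'(3) weight_level_indep[of n ?l g, OF _ gS(1)]
      weight_level_indep[of m ?l g', OF _ g'(2)] by simp
qed

section \<open>Subadditivity of the weight\<close>

lemma block_unions_sym_diff:
  assumes X: "X \<in> block_unions k n" and Y: "Y \<in> block_unions k n"
  shows "sym_diff X Y \<in> block_unions k n"
proof -
  have iff: "s \<in> Z \<longleftrightarrow> r \<in> Z"
    if "Z \<in> block_unions k n" "r \<ge> 1" "s \<ge> 1" "blk k s = blk k r" for Z r s
    using that unfolding block_unions_def mem_Collect_eq by metis
  have sub: "sym_diff X Y \<subseteq> {1..k * n}" using X Y by (auto simp: block_unions_def)
  have "s \<in> sym_diff X Y" if r: "r \<in> sym_diff X Y" and s: "s \<ge> 1" "blk k s = blk k r" for r s
  proof -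
    have "r \<ge> 1" using r sub by auto
    then show ?thesis using r iff[OF X _ s] iff[OF Y _ s] by blast
  qed
  with sub show ?thesis unfolding block_unions_def by blast
qed

lemma image_block_unions_sym_diff:
  assumes a: "bij a" and "X \<in> image a ` block_unions k n" "Y \<in> image a ` block_unions k n"
  shows "sym_diff X Y \<in> image a ` block_unions k n"
proof -
  obtain X' Y' where X': "X' \<in> block_unions k n" "X = a ` X'" and Y': "Y' \<in> block_unions k n" "Y = a ` Y'"
    using assms by blast
  have "sym_diff X Y = a ` sym_diff X' Y'"
    unfolding X' Y' using a by (simp add: image_Un image_set_diff bij_is_inj)
  then show ?thesis using block_unions_sym_diff[OF X'(1) Y'(1)] by blast
qed

lemma weight_subadditive:
  assumes a: "a \<in> S_fin k n" and x: "x \<in> S_fin k n"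
  defines "w \<equiv> \<lambda>g. weight (coset_graph k n g)"
  shows "w x \<le> w a + w (inv a \<circ> x)"
    and "w x = w a + w (inv a \<circ> x) \<Longrightarrow> common_unions n x \<subseteq> image a ` block_unions k n"
proof -
  let ?U = "block_unions k n"
  let ?A = "common_unions n a"
  let ?C = "image a ` ?U"
  let ?B = "?C \<inter> image x ` ?U"
  have bij: "bij a" "bij x" using a x S_fin_bij by blast+
  have inj: "inj (image a)" using bij_is_inj[OF bij(1)] by (simp add: inj_def inj_image_eq_iff)
  have ab: "inv a \<circ> x \<in> S_fin k n" using S_fin_comp S_fin_inv a x by blast
  have "a \<circ> (inv a \<circ> x) = x"
    using surj_iff[THEN iffD1, OF bij_is_surj[OF bij(1)]] by (simp flip: comp_assoc)
  then have "image x ` ?U = image (a \<circ> (inv a \<circ> x)) ` ?U" by simp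
  also have "\<dots> = image a ` (image (inv a \<circ> x) ` ?U)" by (rule image_image_comp)
  finally have "image x ` ?U = image a ` (image (inv a \<circ> x) ` ?U)" .
  \<comment> \<open>This ties the size of \<open>?B\<close> to the weight of the right
    factor.\<close>
  then have "?B = image a ` common_unions n (inv a \<circ> x)"
    by (simp only: common_unions_def image_Int[OF inj])
  then have card_B: "card ?B = card (common_unions n (inv a \<circ> x))"
    using inj by (simp add: card_image inj_on_subset)
  have card_C: "card ?C = 2 ^ n"
    using inj by (simp add: card_image inj_on_subset card_block_unions)
  have AB: "?A \<inter> ?B = common_unions n x \<inter> ?C" by (auto simp: common_unions_def)
  have main: "card ?A * card ?B \<le> 2 ^ n * card (common_unions n x \<inter> ?C)"
    unfolding card_C[symmetric] AB[symmetric]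
  proof (rule card_sym_diff_closed)
    show "finite ?C" by (simp add: finite_block_unions)
    show "?A \<subseteq> ?C" by (simp add: common_unions_def)
    show "sym_diff X Y \<in> ?A" if "X \<in> ?A" "Y \<in> ?A" for X Y
      using that block_unions_sym_diff[of X n Y] image_block_unions_sym_diff[OF bij(1), of X n Y]
      unfolding common_unions_def by blast
    show "sym_diff X Y \<in> ?B" if "X \<in> ?B" "Y \<in> ?B" for X Y
      by (intro IntI image_block_unions_sym_diff[OF bij(1)] image_block_unions_sym_diff[OF bij(2)]
          that[THEN IntD1] that[THEN IntD2])
    show "sym_diff X Y \<in> ?C" if "X \<in> ?C" "Y \<in> ?C" for X Y
      by (rule image_block_unions_sym_diff[OF bij(1) that])
  qed simp
  \<comment> \<open>\<open>p\<close>, \<open>q\<close>, \<open>t\<close> are the dimensions of the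
    three intersections and the weights are \<open>n - p\<close>, \<open>n - q\<close>,
    \<open>n - t\<close>. Subadditivity therefore reads \<open>p + q \<le> n + t\<close>.\<close>
  obtain p where p: "card ?A = 2 ^ p" "w a = int n - int p"
    unfolding w_def by (rule weight_eq[OF a])
  obtain q where q: "card (common_unions n (inv a \<circ> x)) = 2 ^ q" "w (inv a \<circ> x) = int n - int q"
    unfolding w_def by (rule weight_eq[OF ab])
  obtain t where t: "card (common_unions n x) = 2 ^ t" "w x = int n - int t"
    unfolding w_def by (rule weight_eq[OF x])
  have le: "card (common_unions n x \<inter> ?C) \<le> 2 ^ t"
    unfolding t(1)[symmetric] by (simp add: card_mono finite_common_unions)
  have main': "2 ^ (p + q) \<le> 2 ^ n * card (common_unions n x \<inter> ?C)"
    using main unfolding p card_B q by (simp add: power_add)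
  also have "\<dots> \<le> 2 ^ (n + t)" using le by (simp add: power_add)
  finally have "(2::nat) ^ (p + q) \<le> 2 ^ (n + t)" .
  then have "p + q \<le> n + t" by (rule power_le_imp_le_exp[rotated]) simp
  then show "w x \<le> w a + w (inv a \<circ> x)" using p q t by linarith
  assume "w x = w a + w (inv a \<circ> x)"
  \<comment> \<open>Equality leaves no room: the part of \<open>common_unions n x\<close> inside
    \<open>?C\<close> already has all \<open>2 ^ t\<close> elements.\<close>
  then have "p + q = n + t" using p q t by linarith
  then have "2 ^ t \<le> card (common_unions n x \<inter> ?C)" using main' by (simp add: power_add)
  then have "common_unions n x \<inter> ?C = common_unions n x"
    using t(1) finite_common_unions[of n x] by (intro card_seteq) auto
  then show "common_unions n x \<subseteq> ?C" by blast
qed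

section \<open>Stability of the structure coefficients\<close>

lemma left_factors_weight:
  assumes M: "M \<in> double_cosets k" and N: "N \<in> double_cosets k" and L: "L \<in> double_cosets k"
    and x: "x \<in> level k L n" and a: "a \<in> left_factors M N n x"
  shows "coset_weight k L \<le> coset_weight k M + coset_weight k N"
    and "coset_weight k L = coset_weight k M + coset_weight k N \<Longrightarrow>
      common_unions n x \<subseteq> image a ` block_unions k n"
proof -
  have aM: "a \<in> level k M n" and bN: "inv a \<circ> x \<in> level k N n"
    using a by (simp_all add: left_factors_def)
  have "a \<in> S_fin k n" "x \<in> S_fin k n" using aM x by (simp_all add: level_def)
  note * = weight_subadditive[OF this]
  show "coset_weight k L \<le> coset_weight k M + coset_weight k N"
    using *(1) by (simp add: coset_weight_eq[OF M aM] coset_weight_eq[OF N bN] coset_weight_eq[OF L x])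
  show "common_unions n x \<subseteq> image a ` block_unions k n"
    if "coset_weight k L = coset_weight k M + coset_weight k N"
    using *(2) that by (simp add: coset_weight_eq[OF M aM] coset_weight_eq[OF N bN] coset_weight_eq[OF L x])
qed

text \<open>Here \<open>a \<circ> b = (a \<circ> h) \<circ> (inv h \<circ> b)\<close>, and double
  cosets absorb \<open>h\<close> and \<open>inv h\<close>.\<close>

lemma left_factors_mult_H:
  assumes M: "M \<in> double_cosets k" and N: "N \<in> double_cosets k"
    and a: "a \<in> left_factors M N n x" and h: "h \<in> H_fin k n"
  shows "a \<circ> h \<in> left_factors M N n x"
proof -
  have aM: "a \<in> M" "a \<in> S_fin k n" "inv a \<circ> x \<in> N" "inv a \<circ> x \<in> S_fin k n"
    using a by (simp_all add: left_factors_def level_def)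
  have hS: "h \<in> H_inf k" "h \<in> S_fin k n" using h H_fin_subset by blast+
  have eq: "inv (a \<circ> h) \<circ> x = inv h \<circ> (inv a \<circ> x)"
    by (simp add: o_inv_distrib[OF S_fin_bij[OF aM(2)] S_fin_bij[OF hS(2)]] comp_assoc)
  have "a \<circ> h \<in> M" using double_cosets_closed[OF M aM(1) id_in_H_inf hS(1)] by simp
  moreover have "inv h \<circ> (inv a \<circ> x) \<in> N"
    using double_cosets_closed[OF N aM(3) H_inf_inv[OF hS(1)] id_in_H_inf] by simp
  ultimately show ?thesis
    unfolding left_factors_def level_def mem_Collect_eq eq
    using S_fin_comp S_fin_inv aM hS by blast
qed

lemma level_Suc: "level k M n \<subseteq> level k M (Suc n)"
  unfolding level_def using S_fin_mono[of n "Suc n"] by auto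

lemma left_factors_Suc: "left_factors M N n x \<subseteq> left_factors M N (Suc n) x"
  unfolding left_factors_def using level_Suc by blast

text \<open>
  When the weights add up, every common union of blocks of \<open>x\<close> is a union of \<open>b\<close>-images of blocks.
  The last block is such a set since \<open>x\<close> fixes it, so \<open>b\<close> maps a block onto it.
\<close>

lemma left_factors_Suc_decomp:
  assumes M: "M \<in> double_cosets k" and N: "N \<in> double_cosets k" and L: "L \<in> double_cosets k"
    and w: "coset_weight k L = coset_weight k M + coset_weight k N"
    and x: "x \<in> level k L n" and b: "b \<in> left_factors M N (Suc n) x"
  obtains a h where "a \<in> left_factors M N n x" "h \<in> H_fin k (Suc n)" "b = a \<circ> h"
proof -
  let ?G = "Gam k (Suc n)"
  have xS: "x \<in> S_fin k n" "x \<in> level k L (Suc n)" using x level_Suc by (auto simp: level_def)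
  have bS: "b \<in> S_fin k (Suc n)" using b by (simp add: left_factors_def level_def)
  have "?G \<in> block_unions k (Suc n)"
    using Gam_subset[of "Suc n" "Suc n"] by (simp add: block_unions_def mem_Gam_iff)
  moreover from this have "?G \<in> image x ` block_unions k (Suc n)"
    using S_fin_fixes_Gam_Suc(2)[OF xS(1)] by (metis image_eqI)
  ultimately have "?G \<in> image b ` block_unions k (Suc n)"
    using left_factors_weight(2)[OF M N L xS(2) b w] unfolding common_unions_def by blast
  then obtain X where X: "X \<in> block_unions k (Suc n)" "b ` X = ?G" by blast
  then obtain r where r: "r \<in> X" using Gam_nonempty[of "Suc n"] by auto
  let ?j = "blk k r"
  have r1: "1 \<le> r" "r \<le> k * Suc n" using X r by (auto simp: block_unions_def)
  then have j: "1 \<le> ?j" "?j \<le> Suc n" using blk_ge_1 blk_le_iff by blast+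
  \<comment> \<open>\<open>X\<close> is the preimage of the last block; any block inside it already
    fills the last block, by cardinality.\<close>
  have "Gam k ?j \<subseteq> X"
    using X(1) r mem_Gam_iff[OF j(1)] unfolding block_unions_def by blast
  then have "b ` Gam k ?j \<subseteq> ?G" using X(2) by blast
  moreover have "card (b ` Gam k ?j) = card ?G"
    using card_image[OF inj_on_subset[OF bij_is_inj[OF S_fin_bij[OF bS]]], of "Gam k ?j"]
    by (simp add: card_Gam[OF j(1)] card_Gam)
  ultimately have bj: "b ` Gam k ?j = ?G" by (simp add: card_subset_eq)
  \<comment> \<open>The swap agrees with \<open>b\<close> on block \<open>?j\<close>, so
    \<open>b \<circ> inv h\<close> fixes the last block pointwise and drops to level
    \<open>n\<close>.\<close>
  define h where "h = swap_blocks k ?j (Suc n) b"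
  have h: "h \<in> H_fin k (Suc n)"
    unfolding h_def by (rule swap_blocks_in_H_fin[OF S_fin_bij[OF bS] j _ _ bj]) auto
  have hbij: "bij h" using h H_fin_subset(1) S_fin_bij by blast
  define a where "a = b \<circ> inv h"
  have a: "a \<in> left_factors M N (Suc n) x"
    unfolding a_def by (rule left_factors_mult_H[OF M N b H_fin_inv[OF h]])
  have "a r = r" if "r \<in> ?G" for r
  proof -
    obtain s where s: "s \<in> Gam k ?j" "r = b s" using \<open>r \<in> ?G\<close> bj by blast
    then have "h s = r" by (simp add: h_def swap_blocks_def)
    then have "inv h r = s" using bij_is_inj[OF hbij] by (metis inv_f_f)
    then show ?thesis using s by (simp add: a_def)
  qed
  then have "a \<in> S_fin k n"
    using S_fin_Suc_fixing a by (simp add: left_factors_def level_def)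
  then have "a \<in> left_factors M N n x"
    using a xS(1) S_fin_comp S_fin_inv by (simp add: left_factors_def level_def)
  moreover have "b = a \<circ> h"
    using bij_is_inj[OF hbij] by (simp add: a_def comp_assoc)
  ultimately show ?thesis using h that by blast
qed

text \<open>Composition maps pairs of a left factor at level \<open>n\<close> and an element of
  \<open>H_fin k (Suc n)\<close> onto the left factors at level \<open>Suc n\<close>. Every fibre
  has \<open>card (H_fin k n)\<close> elements, and counting the pairs gives the identity.\<close>

lemma card_left_factors_Suc:
  assumes M: "M \<in> double_cosets k" and N: "N \<in> double_cosets k" and L: "L \<in> double_cosets k"
    and w: "coset_weight k L = coset_weight k M + coset_weight k N" and x: "x \<in> level k L n"
  shows "card (left_factors M N (Suc n) x) * card (H_fin k n) =
    card (left_factors M N n x) * card (H_fin k (Suc n))"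
proof -
  let ?F = "left_factors M N n x" and ?F' = "left_factors M N (Suc n) x"
  let ?H = "H_fin k n" and ?H' = "H_fin k (Suc n)"
  let ?P = "?F \<times> ?H'"
  let ?m = "\<lambda>(a, h). a \<circ> h"
  have fibre: "card {p \<in> ?P. ?m p = b} = card ?H" if b: "b \<in> ?F'" for b
  proof -
    obtain a0 h0 where 0: "a0 \<in> ?F" "h0 \<in> ?H'" "b = a0 \<circ> h0"
      by (rule left_factors_Suc_decomp[OF M N L w x b])
    have a0: "a0 \<in> S_fin k n" using 0 by (simp add: left_factors_def level_def)
    have canc: "inv a \<circ> (a \<circ> u) = u" "a \<circ> (inv a \<circ> u) = u" if "bij a" for a :: "nat \<Rightarrow> nat" and u
      using that by (simp_all add: fun_eq_iff bij_is_inj bij_is_surj surj_f_inv_f)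
    \<comment> \<open>The pairs over \<open>b\<close> form a single free orbit of \<open>?H\<close>,
      acting by \<open>(a \<circ> t, inv t \<circ> h)\<close>, with base point
      \<open>(a0, h0)\<close>.\<close>
    have "bij_betw (\<lambda>t. (a0 \<circ> t, inv t \<circ> h0)) ?H {p \<in> ?P. ?m p = b}"
    proof (rule bij_betw_byWitness[where f' = "\<lambda>p. inv a0 \<circ> fst p"])
      show "\<forall>t\<in>?H. inv a0 \<circ> fst (a0 \<circ> t, inv t \<circ> h0) = t"
        by (simp add: canc[OF S_fin_bij[OF a0]])
      show "(\<lambda>t. (a0 \<circ> t, inv t \<circ> h0)) ` ?H \<subseteq> {p \<in> ?P. ?m p = b}"
      proof (rule image_subsetI)
        fix t assume t: "t \<in> ?H"
        have "t \<in> ?H'" using t H_fin_mono[of n "Suc n"] by auto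
        then have "inv t \<circ> h0 \<in> ?H'" using H_fin_comp H_fin_inv 0 by blast
        moreover have "a0 \<circ> t \<in> ?F" by (rule left_factors_mult_H[OF M N 0(1) t])
        moreover have "bij t" using t H_fin_subset(1) S_fin_bij by blast
        ultimately show "(a0 \<circ> t, inv t \<circ> h0) \<in> {p \<in> ?P. ?m p = b}"
          by (simp add: 0 comp_assoc canc)
      qed
      have wit: "inv a0 \<circ> a \<in> ?H \<and> a0 \<circ> (inv a0 \<circ> a) = a \<and> inv (inv a0 \<circ> a) \<circ> h0 = h"
        if a: "a \<in> ?F" and h: "h \<in> ?H'" and eq: "a \<circ> h = b" for a h
      proof (intro conjI)
        have aS: "a \<in> S_fin k n" using a by (simp add: left_factors_def level_def)
        have hb: "bij h" using h H_fin_subset(1) S_fin_bij by blast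
        \<comment> \<open>Written as \<open>h0 \<circ> inv h\<close> the element permutes blocks;
          written as \<open>inv a0 \<circ> a\<close> it has level \<open>n\<close>. Together this
          puts it in \<open>?H\<close>.\<close>
        have "inv a0 \<circ> a = inv a0 \<circ> (a \<circ> h) \<circ> inv h"
          using surj_iff[THEN iffD1, OF bij_is_surj[OF hb]] by (simp add: comp_assoc)
        also have "\<dots> = h0 \<circ> inv h" by (simp add: eq 0 canc[OF S_fin_bij[OF a0]])
        finally have "inv a0 \<circ> a \<in> H_inf k"
          using H_inf_comp H_inf_inv h 0(2) H_fin_subset(2) by (metis subsetD)
        then show "inv a0 \<circ> a \<in> ?H"
          using S_fin_comp S_fin_inv a0 aS by (simp add: H_fin_def)
        show "a0 \<circ> (inv a0 \<circ> a) = a" by (simp add: canc[OF S_fin_bij[OF a0]])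
        have "inv (inv a0 \<circ> a) = inv a \<circ> a0"
          using S_fin_bij[OF a0] S_fin_bij[OF aS] by (simp add: o_inv_distrib bij_imp_bij_inv inv_inv_eq)
        then have "inv (inv a0 \<circ> a) \<circ> h0 = inv a \<circ> (a \<circ> h)" by (simp add: eq 0 comp_assoc)
        then show "inv (inv a0 \<circ> a) \<circ> h0 = h" by (simp add: canc[OF S_fin_bij[OF aS]])
      qed
      show "\<forall>p\<in>{p \<in> ?P. ?m p = b}. (a0 \<circ> (inv a0 \<circ> fst p), inv (inv a0 \<circ> fst p) \<circ> h0) = p"
        using wit by auto
      show "(\<lambda>p. inv a0 \<circ> fst p) ` {p \<in> ?P. ?m p = b} \<subseteq> ?H"
        using wit by auto
    qed
    then show ?thesis by (simp add: bij_betw_same_card)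
  qed
  have "?m ` ?P \<subseteq> ?F'"
    using left_factors_mult_H[OF M N] left_factors_Suc by fastforce
  then have "card ?P = (\<Sum>b\<in>?F'. card {p \<in> ?P. ?m p = b})"
    using sum.group[of ?P ?F' ?m "\<lambda>_. 1::nat"] finite_left_factors finite_H_fin by simp
  also have "\<dots> = card ?F' * card ?H" using fibre by simp
  finally show ?thesis by (simp add: card_cartesian_product)
qed

text \<open>One representative \<open>x\<close> serves at every level from \<open>n\<close> on.
  Dividing \<open>card_left_factors_Suc\<close> by both group orders shows that consecutive
  coefficients agree.\<close>

lemma struct_coeff_stable:
  assumes M: "M \<in> double_cosets k" and N: "N \<in> double_cosets k" and L: "L \<in> double_cosets k"
    and w: "coset_weight k L = coset_weight k M + coset_weight k N"
    and "n \<le> m" "level k L n \<noteq> {}"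
  shows "struct_coeff k M N L m = struct_coeff k M N L n"
proof -
  obtain x where x: "x \<in> level k L n" using assms(6) by blast
  show ?thesis
    using \<open>n \<le> m\<close>
  proof (induction m rule: dec_induct)
    case (step m)
    have xm: "x \<in> level k L m" "x \<in> level k L (Suc m)"
      using x S_fin_mono[OF step.hyps(1)] level_Suc[of L m] by (auto simp: level_def)
    have "of_nat (card (left_factors M N (Suc m) x)) * of_nat (card (H_fin k m)) =
        (of_nat (card (left_factors M N m x)) * of_nat (card (H_fin k (Suc m))) :: complex)"
      using card_left_factors_Suc[OF M N L w xm(1)] by (metis of_nat_mult)
    then have "struct_coeff k M N L (Suc m) = struct_coeff k M N L m"
      using card_H_fin_pos[of m] card_H_fin_pos[of "Suc m"]
      by (simp add: struct_coeff_eq[OF M N L xm(1)] struct_coeff_eq[OF M N L xm(2)] field_simps)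
    then show ?case using step.IH by simp
  qed simp
qed

end

theorem theorem5p3:
  fixes k :: nat and M N L :: "(nat \<Rightarrow> nat) set"
  assumes "k \<ge> 2"
    and "M \<in> double_cosets k" and "N \<in> double_cosets k" and "L \<in> double_cosets k"
  shows "(coset_weight k M + coset_weight k N < coset_weight k L \<longrightarrow>
            (\<forall>n\<ge>1. level k M n \<noteq> {} \<and> level k N n \<noteq> {} \<and> level k L n \<noteq> {} \<longrightarrow>
               struct_coeff k M N L n = 0)) \<and>
         (coset_weight k M + coset_weight k N \<ge> coset_weight k L \<longrightarrow>
            (\<forall>n\<ge>1. level k M n \<noteq> {} \<and> level k N n \<noteq> {} \<and> level k L n \<noteq> {} \<longrightarrow>
               struct_coeff k M N L n \<in> \<real>\<^sub>\<ge>\<^sub>0)) \<and>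
         (coset_weight k L = coset_weight k M + coset_weight k N \<longrightarrow>
            (\<exists>c. \<forall>n\<ge>1. level k M n \<noteq> {} \<and> level k N n \<noteq> {} \<and> level k L n \<noteq> {} \<longrightarrow>
               struct_coeff k M N L n = c))"
proof -
  have k: "k \<ge> 1" using assms(1) by simp
  note MNL = assms(2-4)
  have coeff: "struct_coeff k M N L n =
      of_nat (card (left_factors k M N n x)) / of_nat (card (H_fin k n))"
    if "x \<in> level k L n" for x n
    by (rule struct_coeff_eq[OF k MNL that])
  have zero: "struct_coeff k M N L n = 0"
    if w: "coset_weight k M + coset_weight k N < coset_weight k L" and L: "level k L n \<noteq> {}" for n
  proof -
    obtain x where x: "x \<in> level k L n" using L by blast
    \<comment> \<open>A factorization of \<open>x\<close> would contradict subadditivity of the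
      weight.\<close>
    have "left_factors k M N n x = {}"
      using left_factors_weight(1)[OF k MNL x] w by fastforce
    then show ?thesis by (simp add: coeff[OF x])
  qed
  have nonneg: "struct_coeff k M N L n \<in> \<real>\<^sub>\<ge>\<^sub>0" if L: "level k L n \<noteq> {}" for n
  proof -
    obtain x where x: "x \<in> level k L n" using L by blast
    show ?thesis unfolding coeff[OF x] by (intro nonneg_Reals_divide_I nonneg_Reals_of_nat_I)
  qed
  have const: "\<exists>c. \<forall>n. level k L n \<noteq> {} \<longrightarrow> struct_coeff k M N L n = c"
    if w: "coset_weight k L = coset_weight k M + coset_weight k N"
  proof -
    \<comment> \<open>Stability runs upward, so the smaller of the two levels is the starting
      point.\<close>
    have "struct_coeff k M N L n = struct_coeff k M N L m"
      if "level k L n \<noteq> {}" "level k L m \<noteq> {}" for n m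
      using struct_coeff_stable[OF k MNL w _ that(1), of m]
        struct_coeff_stable[OF k MNL w _ that(2), of n] by (cases "n \<le> m") simp_all
    then show ?thesis by blast
  qed
  show ?thesis
  proof (intro conjI impI)
    assume w: "coset_weight k L = coset_weight k M + coset_weight k N"
    show "\<exists>c. \<forall>n\<ge>1. level k M n \<noteq> {} \<and> level k N n \<noteq> {} \<and> level k L n \<noteq> {} \<longrightarrow>
        struct_coeff k M N L n = c"
      using const[OF w] by (elim ex_forward) simp
  qed (simp_all add: zero nonneg)
qed

end
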